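(* Let $d\ge 2$ and let $\mathbf M=(M_n)_{n\in\mathbb Z}\in\mathcal M_d^{\mathbb Z}$ be a primitive sequence of nonnegative unimodular integer matrices satisfying the local Pisot condition and the growth condition $\lim_{n\to\infty}\frac1n\log\lVert M_n\rVert=0$. Then $\mathbf M$ is algebraically irreducible and admits a generalized right eigenvector with rationally independent coordinates to which it converges exponentially. An analogous result holds for the past: if the sequence $(M_{-n-1}^{\top})_{n\in\mathbb Z}$ is primitive and satisfies the local Pisot condition and the growth condition $\lim_{n\to\infty}\frac1n\log\lVert M_{-n-1}^{\top}\rVert=0$, then the sequence $(M_{-n-1}^{\top})_{n\in\mathbb Z}$ is algebraically irreducible and admits a generalized right eigenvector with rationally independent coordinates to which it converges exponentially (so that $\mathbf M$ admits a generalized left eigenvector with rationally independent coordinates to which it converges exponentially in the past).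
   Context: $\mathcal M_d$ is the set of $d\times d$ matrices with nonnegative integer entries and determinant $\pm1$; $M^\top$ is the transpose; $\lVert\cdot\rVert$ is any matrix norm; $M_{[m,n)}=M_mM_{m+1}\cdots M_{n-1}$ for $m\le n$ (identity if $m=n$). A matrix is positive if all its entries are $>0$. $\mathbf e_1,\dots,\mathbf e_d$ is the standard basis of $\mathbb R^d$ and $\mathrm d$ is Euclidean distance. Primitive: for each $m\in\mathbb Z$ there is $n>m$ such that $M_{[m,n)}$ is positive. Local Pisot condition: $\limsup_{n\to\infty}\frac1n\log\delta_2(M_{[0,n)})<0$, where $\delta_1(M)\ge\delta_2(M)\ge\cdots\ge\delta_d(M)$ are the singular values of $M$. Algebraically irreducible: for each $m\in\mathbb Z$ there is $n_0\in\mathbb N$ such that the characteristic polynomial of $M_{[m,n)}$ is irreducible for each $n\ge n_0$. Generalized right eigenvector of $\mathbf M$: a vector $\mathbf u\in\mathbb R_{\ge0}^d\setminus\{\mathbf 0\}$ with $\bigcap_{n\in\mathbb N}M_{[0,n)}\mathbb R_{\ge0}^d=\mathbb R_{\ge0}\mathbf u$. A generalized left eigenvector of $\mathbf M$ is a $\mathbf v\in\mathbb R_{\ge0}^d\setminus\{\mathbf 0\}$ with $\bigcap_{n\in\mathbb N}M_{[-n,0)}^{\top}\mathbb R_{\ge0}^d=\mathbb R_{\ge0}\mathbf v$, i.e. a generalized right eigenvector of $(M_{-n-1}^{\top})_{n\in\mathbb Z}$. $\mathbf M$ converges exponentially to $\mathbf u$ if there are $C,\alpha>0$ with $\mathrm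 d(M_{[0,n)}\mathbf e_i,\mathbb R\mathbf u)\le Ce^{-\alpha n}$ for all $n\in\mathbb N$, $i\in\{1,\dots,d\}$; it converges exponentially in the past if $(M_{-n-1}^{\top})_{n\in\mathbb Z}$ converges exponentially. *)

theory Defs
  imports "HOL-Analysis.Analysis" "HOL-Computational_Algebra.Computational_Algebra"
begin

abbreviation of_int_mat :: "int ^ 'm ^ 'n \<Rightarrow> 'a::ring_1 ^ 'm ^ 'n" where
  "of_int_mat \<equiv> map_matrix of_int"

definition charpoly :: "'a::comm_ring_1 ^ 'n ^ 'n \<Rightarrow> 'a poly" where
  "charpoly A = det (mat [:0, 1:] - map_matrix (\<lambda>a. [:a:]) A)"

text \<open>
  The singular values in decreasing order, repeated according to multiplicity: the square roots
  of the eigenvalues of the Gram matrix, which is positive semidefinite, so that all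
  \<open>CARD('n)\<close> roots of its characteristic polynomial are real.
\<close>

definition singular_values :: "real ^ 'n ^ 'n \<Rightarrow> real list" where
  "singular_values A =
     map sqrt (rev (sorted_list_of_multiset (proots (charpoly (transpose A ** A)))))"

text \<open>The numbering of singular values starts at 1.\<close>

definition singular_value :: "nat \<Rightarrow> real ^ 'n ^ 'n \<Rightarrow> real" where
  "singular_value k A = singular_values A ! (k - 1)"

text \<open>
  Norms on the vector space of real square matrices; submultiplicativity is not required.
\<close>

definition is_matrix_norm :: "(real ^ 'n ^ 'n \<Rightarrow> real) \<Rightarrow> bool" where
  "is_matrix_norm N \<longleftrightarrow>
     (\<forall>A. N A = 0 \<longleftrightarrow> A = 0) \<and>
     (\<forall>c A. N (c *\<^sub>R A) = \<bar>c\<bar> * N A) \<and>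
     (\<forall>A B. N (A + B) \<le> N A + N B)"

definition nonneg_unimodular :: "(int ^ 'n ^ 'n) set" where
  "nonneg_unimodular = {A. (\<forall>i j. 0 \<le> A $ i $ j) \<and> (det A = 1 \<or> det A = - 1)}"

definition positive_mat :: "int ^ 'n ^ 'n \<Rightarrow> bool" where
  "positive_mat A \<longleftrightarrow> (\<forall>i j. 0 < A $ i $ j)"

text \<open>
  The product \<open>M m ** M (m + 1) ** \<dots> ** M (n - 1)\<close>, with the convention that
  it is the identity for \<open>n \<le> m\<close>.
\<close>

definition mprod :: "(int \<Rightarrow> int ^ 'n ^ 'n) \<Rightarrow> int \<Rightarrow> int \<Rightarrow> int ^ 'n ^ 'n" where
  "mprod M m n = foldr (\<lambda>k A. M k ** A) [m..n - 1] (mat 1)"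

definition past :: "(int \<Rightarrow> int ^ 'n ^ 'n) \<Rightarrow> int \<Rightarrow> int ^ 'n ^ 'n" where
  "past M n = transpose (M (- n - 1))"

definition primitive :: "(int \<Rightarrow> int ^ 'n ^ 'n) \<Rightarrow> bool" where
  "primitive M \<longleftrightarrow> (\<forall>m. \<exists>n>m. positive_mat (mprod M m n))"

definition local_Pisot :: "(int \<Rightarrow> int ^ 'n ^ 'n) \<Rightarrow> bool" where
  "local_Pisot M \<longleftrightarrow>
     limsup (\<lambda>n. ereal (1 / real n * ln (singular_value 2 (of_int_mat (mprod M 0 (int n)))))) < 0"

definition growth_condition ::
    "(real ^ 'n ^ 'n \<Rightarrow> real) \<Rightarrow> (int \<Rightarrow> int ^ 'n ^ 'n) \<Rightarrow> bool" where
  "growth_condition N M \<longleftrightarrow>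
     (\<lambda>n. 1 / real n * ln (N (of_int_mat (M (int n))))) \<longlonglongrightarrow> 0"

text \<open>
  Irreducibility is understood over the rationals.  For \<open>CARD('n) \<ge> 2\<close> the product with
  \<open>n \<le> m\<close>, being the identity, has a reducible characteristic polynomial, so that \<open>n0 > m\<close>
  is forced; this is harmless since \<open>n0\<close> may depend on \<open>m\<close>.
\<close>

definition alg_irreducible :: "(int \<Rightarrow> int ^ 'n ^ 'n) \<Rightarrow> bool" where
  "alg_irreducible M \<longleftrightarrow>
     (\<forall>m. \<exists>n0::nat. \<forall>n\<ge>int n0.
        irreducible (charpoly (of_int_mat (mprod M m n) :: rat ^ 'n ^ 'n)))"

definition nonneg_orthant :: "(real ^ 'n) set" where
  "nonneg_orthant = {x. \<forall>i. 0 \<le> x $ i}"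

definition generalized_right_eigenvector ::
    "(int \<Rightarrow> int ^ 'n ^ 'n) \<Rightarrow> real ^ 'n \<Rightarrow> bool" where
  "generalized_right_eigenvector M u \<longleftrightarrow>
     u \<in> nonneg_orthant - {0} \<and>
     (\<Inter>n::nat. (*v) (of_int_mat (mprod M 0 (int n))) ` nonneg_orthant)
       = {t *\<^sub>R u | t. 0 \<le> t}"

definition generalized_left_eigenvector ::
    "(int \<Rightarrow> int ^ 'n ^ 'n) \<Rightarrow> real ^ 'n \<Rightarrow> bool" where
  "generalized_left_eigenvector M v \<longleftrightarrow>
     v \<in> nonneg_orthant - {0} \<and>
     (\<Inter>n::nat. (*v) (transpose (of_int_mat (mprod M (- int n) 0))) ` nonneg_orthant)
       = {t *\<^sub>R v | t. 0 \<le> t}"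

definition converges_exponentially ::
    "(int \<Rightarrow> int ^ 'n ^ 'n) \<Rightarrow> real ^ 'n \<Rightarrow> bool" where
  "converges_exponentially M u \<longleftrightarrow>
     (\<exists>C>0. \<exists>\<alpha>>0. \<forall>n::nat. \<forall>i.
        infdist (of_int_mat (mprod M 0 (int n)) *v axis i 1) (span {u}) \<le> C * exp (- \<alpha> * real n))"

definition converges_exponentially_past ::
    "(int \<Rightarrow> int ^ 'n ^ 'n) \<Rightarrow> real ^ 'n \<Rightarrow> bool" where
  "converges_exponentially_past M v \<longleftrightarrow> converges_exponentially (past M) v"

definition rationally_independent :: "real ^ 'n \<Rightarrow> bool" where
  "rationally_independent u \<longleftrightarrow>
     (\<forall>c :: 'n \<Rightarrow> rat. (\<Sum>i\<in>UNIV. of_rat (c i) * u $ i) = 0 \<longrightarrow> (\<forall>i. c i = 0))"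

end

theory Submission
  imports Defs
begin

text \<open>
  Everything is controlled by the \<open>2 \<times> 2\<close> minors of the products \<open>P n\<close>. They are at most a constant
  times \<open>\<delta>\<^sub>1 \<delta>\<^sub>2\<close>, so relative to the size of \<open>P n\<close> they decay exponentially, and still do so
  after multiplication by the norm of the next factor. Since cross products of the columns bound
  the distance between their normalisations, the normalised column sums form a Cauchy sequence with
  a limit \<open>u\<close>, and the columns themselves approach the line of \<open>u\<close>. An integer vector orthogonal to
  \<open>u\<close> is then orthogonal to the columns of \<open>P n\<close> for large \<open>n\<close>, hence zero.

  For irreducibility, primitivity makes the Perron--Frobenius eigenvalue \<open>\<rho>\<close> comparable to the size
  of the matrix, whereas the product of \<open>\<rho>\<close> with any other eigenvalue is bounded by the minors.
  Hence all other eigenvalues lie in the open unit disc, which is impossible for all the roots of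
  an integer factor of a monic polynomial with nonzero constant coefficient.
\<close>

text \<open>Closeness of directions alone would not suffice: the columns of \<open>P n\<close> may
  grow, and a small angle can leave a large distance from the line of \<open>u\<close>. Minors are
  suited to this because a minor of order \<open>\<beta> ^ n\<close> times the size of
  \<open>P n\<close>, divided by the product of two sizes, bounds an angle by
  \<open>\<beta> ^ n\<close> over the size. That denominator has to survive the summation over all
  later steps, which it does because entry sums never decrease along the sequence; multiplied by the
  length of a column it then cancels, and an absolute error remains.

  A single step compares the images under \<open>P n\<close> of two vectors, the all-ones vector and
  its image under the next factor; the length of the latter is what the growth condition has to pay
  for.

  On the algebraic side minors are the entries of the second exterior power, where
  \<open>\<rho> * \<mu>\<close> appears as an eigenvalue. Working there avoids having to know that
  \<open>\<rho>\<close> is a simple root or that the matrix is diagonalisable.\<close>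

no_notation fps_nth (infixl \<open>$\<close> 75)

section \<open>Singular values and minors\<close>

lemma symmetric_eigenvector_in_subspace:
  fixes A :: "real ^ 'n ^ 'n"
  assumes sym: "transpose A = A" and S: "subspace S" and nz: "x0 \<in> S" "x0 \<noteq> 0"
    and inv: "\<And>x. x \<in> S \<Longrightarrow> A *v x \<in> S"
  obtains x l where "x \<in> S" "norm x = 1" "A *v x = l *\<^sub>R x"
proof -
  have adj: "x \<bullet> (A *v y) = (A *v x) \<bullet> y" for x y
    using sym by (metis dot_lmul_matrix vector_transpose_matrix)
  define K where "K = S \<inter> sphere 0 1"
  have "compact K"
    unfolding K_def by (intro closed_Int_compact closed_subspace S compact_sphere)
  moreover have "(1 / norm x0) *\<^sub>R x0 \<in> K"
    using nz S by (auto simp: K_def subspace_scale)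
  moreover have "continuous_on K (\<lambda>x. x \<bullet> (A *v x))"
    by (intro continuous_intros matrix_vector_mult_linear_continuous_on)
  ultimately obtain x where x: "x \<in> K" and max: "\<And>y. y \<in> K \<Longrightarrow> y \<bullet> (A *v y) \<le> x \<bullet> (A *v x)"
    using continuous_attains_sup[of K "\<lambda>x. x \<bullet> (A *v x)"] by blast
  define l where "l = x \<bullet> (A *v x)"
  have xx: "x \<bullet> x = 1" "x \<in> S" "norm x = 1"
    using x by (auto simp: K_def dot_square_norm)
  have ray: "w \<bullet> (A *v w) \<le> l * (w \<bullet> w)" if "w \<in> S" for w
  proof (cases "w = 0")
    case False
    define c where "c = 1 / norm w"
    have "c *\<^sub>R w \<in> K" using that False S by (auto simp: K_def c_def subspace_scale)
    from max[OF this] have "c\<^sup>2 * (w \<bullet> (A *v w)) \<le> l"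
      by (simp add: matrix_vector_mult_scaleR l_def power2_eq_square mult.assoc)
    then show ?thesis using False
      by (simp add: c_def power_divide field_simps dot_square_norm)
  qed auto
  \<comment> \<open>\<open>g\<close> is the residual of the eigenvalue equation at the maximiser
    \<open>x\<close>. It lies in \<open>S\<close> by invariance, so \<open>x\<close> may be moved in
    its direction; for small \<open>t\<close> the first-order gain
    \<open>2 * t * (g \<bullet> g)\<close> would beat the second-order term \<open>k\<close>, unless
    \<open>g = 0\<close>.\<close>
  define g where "g = A *v x - l *\<^sub>R x"
  have gS: "g \<in> S" unfolding g_def by (intro subspace_diff subspace_scale S inv xx)
  define k where "k = l * (g \<bullet> g) - g \<bullet> (A *v g)"
  have k: "0 \<le> k" using ray[OF gS] by (simp add: k_def)
  have quad: "2 * t * (g \<bullet> g) \<le> t\<^sup>2 * k" for t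
  proof -
    have "x + t *\<^sub>R g \<in> S" by (intro subspace_add subspace_scale S xx gS)
    from ray[OF this]
    have *: "l + t * (x \<bullet> (A *v g)) + t * (g \<bullet> (A *v x)) + t\<^sup>2 * (g \<bullet> (A *v g))
       \<le> l * (1 + 2 * t * (x \<bullet> g) + t\<^sup>2 * (g \<bullet> g))"
      by (simp add: matrix_vector_mult_scaleR matrix_vector_right_distrib inner_add_left
          inner_add_right xx inner_commute[of g x] power2_eq_square algebra_simps l_def)
    have "x \<bullet> (A *v g) = g \<bullet> (A *v x)" using adj by (metis inner_commute)
    moreover have "g \<bullet> (A *v x) = g \<bullet> g + l * (x \<bullet> g)"
      by (simp add: g_def inner_diff_right inner_commute[of g x] inner_diff_left inner_commute algebra_simps)
    ultimately show ?thesis using * by (simp add: k_def algebra_simps)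
  qed
  have "g \<bullet> g = 0"
  proof (rule ccontr)
    assume "g \<bullet> g \<noteq> 0"
    then have p: "g \<bullet> g > 0" by (simp add: order_less_le)
    define t where "t = (g \<bullet> g) / (k + 1)"
    have t: "t > 0" using p k by (simp add: t_def)
    have "2 * (g \<bullet> g) \<le> t * k"
      using quad[of t] t by (simp add: power2_eq_square)
    also have "t * k \<le> g \<bullet> g" using p k by (simp add: t_def field_simps)
    finally show False using p by simp
  qed
  then have "A *v x = l *\<^sub>R x" by (simp add: g_def)
  then show ?thesis using xx that by blast
qed

text \<open>Eigenvectors are collected one at a time: the orthogonal complement of those found so
  far is invariant by symmetry, and nonzero while fewer than \<open>CARD('n)\<close> are known.
  Indexing them by \<open>'n\<close> makes them the columns of a square matrix.\<close>

lemma symmetric_orthonormal_eigenvectors: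
  fixes A :: "real ^ 'n ^ 'n"
  assumes sym: "transpose A = A"
  obtains q l where "\<And>i j :: 'n. q i \<bullet> q j = (if i = j then 1 else 0)"
    "\<And>i. A *v q i = l i *\<^sub>R q i"
proof -
  have adj: "x \<bullet> (A *v y) = (A *v x) \<bullet> y" for x y
    using sym by (metis dot_lmul_matrix vector_transpose_matrix)
  have "\<exists>B. finite B \<and> card B = k \<and> pairwise orthogonal B \<and>
      (\<forall>b\<in>B. norm b = 1 \<and> (\<exists>l. A *v b = l *\<^sub>R b))" if "k \<le> CARD('n)" for k
    using that
  proof (induction k)
    case 0
    show ?case by (intro exI[of _ "{}"]) auto
  next
    case (Suc k)
    then obtain B where B: "finite B" "card B = k" "pairwise orthogonal B"
      "\<And>b. b \<in> B \<Longrightarrow> norm b = 1 \<and> (\<exists>l. A *v b = l *\<^sub>R b)" by auto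
    define S where "S = {x. \<forall>b\<in>B. b \<bullet> x = 0}"
    have "dim B < DIM(real ^ 'n)" using dim_le_card'[OF B(1)] B(2) Suc.prems by simp
    then obtain x0 where x0: "x0 \<noteq> 0" "\<And>y. y \<in> span B \<Longrightarrow> orthogonal x0 y"
      using orthogonal_to_subspace_exists by blast
    then have "x0 \<in> S" by (auto simp: S_def orthogonal_def span_base inner_commute)
    moreover have "subspace S"
      by (auto simp: S_def subspace_def inner_add_right)
    moreover have "A *v x \<in> S" if "x \<in> S" for x
      using that B(4) by (fastforce simp: S_def adj)
    ultimately obtain x l where x: "x \<in> S" "norm x = 1" "A *v x = l *\<^sub>R x"
      using symmetric_eigenvector_in_subspace[OF sym] x0(1) by metis
    have "x \<notin> B" using x by (auto simp: S_def dot_square_norm)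
    moreover have "orthogonal x b" "orthogonal b x" if "b \<in> B" for b
      using x(1) that by (auto simp: S_def orthogonal_def inner_commute)
    ultimately show ?case using B x
      by (intro exI[of _ "insert x B"]) (auto simp: pairwise_insert)
  qed
  from this[OF order_refl] obtain B where B: "finite B" "card B = CARD('n)" "pairwise orthogonal B"
      "\<And>b. b \<in> B \<Longrightarrow> norm b = 1 \<and> (\<exists>l. A *v b = l *\<^sub>R b)" by blast
  then obtain q :: "'n \<Rightarrow> real ^ 'n" where q: "bij_betw q UNIV B"
    using finite_same_card_bij[of "UNIV :: 'n set" B] by auto
  then have qB: "q i \<in> B" for i by (auto simp: bij_betw_def)
  obtain l where "\<And>i. A *v q i = l i *\<^sub>R q i" using B(4)[OF qB] by metis
  moreover have "q i \<bullet> q j = (if i = j then 1 else 0)" for i j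
  proof (cases "i = j")
    case True
    then show ?thesis using B(4)[OF qB] by (simp add: dot_square_norm)
  next
    case False
    then have "q i \<noteq> q j" using q by (simp add: bij_betw_def inj_eq)
    then show ?thesis using pairwiseD[OF B(3) qB qB] False by (simp add: orthogonal_def)
  qed
  ultimately show ?thesis using that by blast
qed

section \<open>Characteristic polynomials under ring homomorphisms\<close>

lemma det_map_matrix:
  assumes "\<And>x y. h (x + y) = h x + h y" "\<And>x y. h (x * y) = h x * h y"
    "h 0 = 0" "h 1 = 1" "\<And>x. h (- x) = - h x"
  shows "det (map_matrix h A) = (h (det A) :: 'b::comm_ring_1)"
proof -
  have s: "h (sum f S) = (\<Sum>x\<in>S. h (f x))" if "finite S" for f :: "('n \<Rightarrow> 'n) \<Rightarrow> 'a" and S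
    using that by (induction S) (auto simp: assms)
  have p: "h (prod f S) = (\<Prod>x\<in>S. h (f x))" if "finite S" for f :: "'n \<Rightarrow> 'a" and S
    using that by (induction S) (auto simp: assms)
  have g: "h (of_int (sign p)) = of_int (sign p)" for p :: "'n \<Rightarrow> 'n"
    by (simp add: sign_def assms)
  show ?thesis
    by (simp add: det_def s p g assms map_matrix_def finite_permutations)
qed

lemma map_matrix_mult:
  assumes "\<And>x y. h (x + y) = h x + h y" "\<And>x y. h (x * y) = h x * h y" "h 0 = 0"
  shows "map_matrix h (A ** B) = map_matrix h A ** (map_matrix h B :: 'b::semiring_1 ^ 'm ^ 'n)"
proof -
  have s: "h (sum f S) = (\<Sum>x\<in>S. h (f x))" if "finite S" for f :: "_ \<Rightarrow> 'a::semiring_1" and S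
    using that by (induction S) (auto simp: assms)
  show ?thesis
    by (simp add: matrix_matrix_mult_def map_matrix_def vec_eq_iff s assms)
qed

lemma poly_charpoly:
  fixes A :: "'a::comm_ring_1 ^ 'n ^ 'n"
  shows "poly (charpoly A) x = det (mat x - A)"
proof -
  have "poly (charpoly A) x = det (map_matrix (\<lambda>p. poly p x) (mat [:0, 1:] - map_matrix (\<lambda>a. [:a:]) A))"
    unfolding charpoly_def by (rule det_map_matrix[symmetric]) auto
  also have "map_matrix (\<lambda>p. poly p x) (mat [:0, 1:] - map_matrix (\<lambda>a. [:a:]) A) = mat x - A"
    by (simp add: map_matrix_def mat_def vec_eq_iff)
  finally show ?thesis .
qed

text \<open>The orthogonal matrix \<open>Q\<close> of eigenvectors diagonalises
  \<open>mat x - A\<close>. The result is an identity of polynomials and not only of root sets,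
  because \<open>singular_values\<close> repeats its entries according to multiplicity.\<close>

lemma charpoly_symmetric:
  fixes A :: "real ^ 'n ^ 'n"
  assumes q: "\<And>i j :: 'n. q i \<bullet> q j = (if i = j then 1 else 0)"
    and l: "\<And>i. A *v q i = l i *\<^sub>R q i"
  shows "charpoly A = (\<Prod>i\<in>UNIV. [:- l i, 1:])"
proof -
  define Q :: "real ^ 'n ^ 'n" where "Q = (\<chi> i j. q j $ i)"
  have QQ: "transpose Q ** Q = mat 1"
    using q by (simp add: Q_def matrix_matrix_mult_def transpose_def mat_def vec_eq_iff inner_vec_def)
  then have dQ: "det (transpose Q) * det Q = 1" by (metis det_I det_mul)
  have "det (mat x - A) = (\<Prod>i\<in>UNIV. x - l i)" for x
  proof -
    have Aq: "(\<Sum>k\<in>UNIV. A $ i $ k * q j $ k) = l j * q j $ i" for i j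
      using l[of j] by (simp add: matrix_vector_mult_def vec_eq_iff)
    have xq: "(\<Sum>k\<in>UNIV. mat x $ i $ k * q j $ k) = x * q j $ i" for i j
      by (simp add: mat_def if_distrib[of "\<lambda>t. t * _"] cong: if_cong)
    have "((mat x - A) ** Q) $ i $ j = (x - l j) * q j $ i" for i j
      using Aq xq
      by (simp add: matrix_matrix_mult_def Q_def left_diff_distrib sum_subtractf)
    then have "(transpose Q ** ((mat x - A) ** Q)) $ i $ j = (x - l j) * (q i \<bullet> q j)" for i j
      unfolding matrix_matrix_mult_def[of "transpose Q"]
      by (simp add: transpose_def inner_vec_def sum_distrib_left mult_ac) (simp add: Q_def mult_ac)
    then have e: "transpose Q ** ((mat x - A) ** Q) = (\<chi> i j. if i = j then x - l i else 0)"
      by (simp add: q vec_eq_iff)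
    have "det (mat x - A) = det (transpose Q ** ((mat x - A) ** Q))"
      using dQ by (simp add: det_mul mult_ac)
    also have "\<dots> = (\<Prod>i\<in>UNIV. x - l i)"
      unfolding e by (subst det_diagonal) auto
    finally show ?thesis .
  qed
  then have "poly (charpoly A) x = poly (\<Prod>i\<in>UNIV. [:- l i, 1:]) x" for x
    by (simp add: poly_charpoly poly_prod)
  then show ?thesis by (metis poly_eq_poly_eq_iff ext)
qed

text \<open>Only the head of the decreasing list can exceed its second entry, whereas both
  \<open>a\<close> and \<open>b\<close> would exceed it if the claim failed. Taking \<open>b\<close>
  from \<open>X - {#a#}\<close> makes equal values count only when they occur twice.\<close>

lemma sorted_list_second_largest:
  fixes X :: "'a::linorder multiset"
  assumes "a \<in># X" "b \<in># X - {#a#}"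
  shows "min a b \<le> rev (sorted_list_of_multiset X) ! 1"
proof -
  define xs where "xs = rev (sorted_list_of_multiset X)"
  have mx: "mset xs = X" by (simp add: xs_def)
  have srt: "sorted_wrt (\<ge>) xs"
    unfolding xs_def sorted_wrt_rev by simp
  obtain Z where X: "X = add_mset a (add_mset b Z)"
    using assms by (metis add_mset_remove_trivial multi_member_split)
  then have "length xs \<ge> 2" using mx by (metis size_mset size_add_mset le_add1 add_2_eq_Suc' numeral_2_eq_2 Suc_le_mono le0)
  then obtain x y zs where xs: "xs = x # y # zs"
    using mx by (cases xs; cases "tl xs") auto
  have "min a b \<le> y"
  proof (rule ccontr)
    assume "\<not> min a b \<le> y"
    then have *: "y < a \<and> y < b" by (simp add: min_le_iff_disj not_le)
    have "filter (\<lambda>z. y < z) zs = []" using srt xs by (auto simp: filter_empty_conv)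
    then have "length (filter (\<lambda>z. y < z) xs) \<le> 1" using xs by simp
    moreover have "length (filter (\<lambda>z. y < z) xs) = size (filter_mset (\<lambda>z. y < z) X)"
      using mx by (metis mset_filter size_mset)
    ultimately show False using * by (simp add: X)
  qed
  then show ?thesis using xs by (simp add: xs_def)
qed

text \<open>The norm used in all estimates: it is submultiplicative, and on nonnegative matrices it
  is the coordinate sum of the image of the all-ones vector.\<close>

definition entry_sum :: "real ^ 'm ^ 'n \<Rightarrow> real" where
  "entry_sum A = (\<Sum>i\<in>UNIV. \<Sum>j\<in>UNIV. \<bar>A $ i $ j\<bar>)"

text \<open>Rows or columns may coincide, and then the value is 0; sums can thus run over all index
  pairs without ordering them.\<close>

definition minor :: "'a::comm_ring_1 ^ 'm ^ 'n \<Rightarrow> 'n \<Rightarrow> 'n \<Rightarrow> 'm \<Rightarrow> 'm \<Rightarrow> 'a" where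
  "minor A i j k l = A $ i $ k * A $ j $ l - A $ i $ l * A $ j $ k"

lemma entry_sum_nonneg: "0 \<le> entry_sum A"
  by (simp add: entry_sum_def sum_nonneg)

lemma abs_le_entry_sum: "\<bar>A $ i $ j\<bar> \<le> entry_sum A"
proof -
  have "\<bar>A $ i $ j\<bar> \<le> (\<Sum>j\<in>UNIV. \<bar>A $ i $ j\<bar>)"
    by (rule member_le_sum) auto
  also have "\<dots> \<le> entry_sum A"
    unfolding entry_sum_def by (rule member_le_sum[of i UNIV "\<lambda>i. \<Sum>j\<in>UNIV. \<bar>A $ i $ j\<bar>"]) (auto intro: sum_nonneg)
  finally show ?thesis .
qed

lemma norm_mult_le_entry_sum: "norm (A *v x) \<le> entry_sum A * norm x"
proof -
  have "norm (A *v x) \<le> (\<Sum>i\<in>UNIV. \<bar>(A *v x) $ i\<bar>)" by (rule norm_le_l1_cart)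
  also have "\<dots> \<le> (\<Sum>i\<in>UNIV. \<Sum>j\<in>UNIV. \<bar>A $ i $ j\<bar> * norm x)"
  proof (rule sum_mono)
    fix i
    have "\<bar>(A *v x) $ i\<bar> \<le> (\<Sum>j\<in>UNIV. \<bar>A $ i $ j * x $ j\<bar>)"
      by (simp add: matrix_vector_mult_def sum_abs)
    also have "\<dots> \<le> (\<Sum>j\<in>UNIV. \<bar>A $ i $ j\<bar> * norm x)"
      by (intro sum_mono) (auto simp: abs_mult intro!: mult_left_mono component_le_norm_cart)
    finally show "\<bar>(A *v x) $ i\<bar> \<le> (\<Sum>j\<in>UNIV. \<bar>A $ i $ j\<bar> * norm x)" .
  qed
  also have "\<dots> = entry_sum A * norm x"
    by (simp add: entry_sum_def sum_distrib_right)
  finally show ?thesis .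
qed

text \<open>
  With orthonormal eigenvectors \<open>q r\<close> of the Gram matrix, \<open>A = (\<Sum>r. (A *v q r) (q r)\<^sup>T)\<close>;
  rank one terms have no minors, so only products of two distinct singular values survive.
\<close>

lemma minor_le_singular_value_2:
  fixes A :: "real ^ 'n ^ 'n"
  assumes "CARD('n) \<ge> 2"
  shows "\<bar>minor A i j k l\<bar> \<le> 2 * (real CARD('n))\<^sup>2 * entry_sum A * singular_value 2 A"
proof -
  define G where "G = transpose A ** A"
  have "transpose G = G" by (simp add: G_def matrix_transpose_mul)
  then obtain q e where q: "\<And>r s :: 'n. q r \<bullet> q s = (if r = s then 1 else 0)"
    and e: "\<And>r. G *v q r = e r *\<^sub>R q r"
    using symmetric_orthonormal_eigenvectors by blast
  have e2: "e r = (norm (A *v q r))\<^sup>2" for r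
  proof -
    have "(norm (A *v q r))\<^sup>2 = q r \<bullet> (G *v q r)"
      unfolding G_def matrix_vector_mul_assoc[symmetric] dot_square_norm[symmetric]
      by (metis dot_lmul_matrix inner_commute vector_transpose_matrix)
    then show ?thesis by (simp add: e q)
  qed
  have "charpoly G = (\<Prod>r\<in>UNIV. [:- e r, 1:])" by (rule charpoly_symmetric[OF q e])
  then have "proots (charpoly G) = (\<Sum>r\<in>UNIV. {#e r#})"
    by (simp add: proots_prod)
  then have pr: "proots (charpoly G) = image_mset e (mset_set UNIV)"
    by (simp add: sum_unfold_sum_mset)
  have nq: "norm (q r) = 1" for r using q[of r r] by (simp add: norm_eq_1)
  define a where "a r = A *v q r" for r
  \<comment> \<open>The smaller of two norms with distinct indices is at most the second singular
    value, and the larger is at most \<open>entry_sum A\<close>, which stands in for the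
    first.\<close>
  have small: "norm (a r) * norm (a s) \<le> entry_sum A * singular_value 2 A" if "r \<noteq> s" for r s
  proof -
    define t where "t = rev (sorted_list_of_multiset (image_mset e (mset_set UNIV))) ! 1"
    have "mset_set UNIV = mset_set (insert r (insert s (UNIV - {r, s})))"
      by (rule arg_cong[of _ _ mset_set]) auto
    also have "\<dots> = add_mset r (add_mset s (mset_set (UNIV - {r, s})))"
      using that by simp
    finally have sub: "mset_set UNIV = add_mset r (add_mset s (mset_set (UNIV - {r, s})))" .
    have "length (sorted_list_of_multiset (image_mset e (mset_set UNIV))) = CARD('n)"
      by (simp add: size_mset[symmetric] del: size_mset)
    then have "1 < length (sorted_list_of_multiset (image_mset e (mset_set UNIV)))" using assms by simp
    then have "singular_value 2 A = sqrt t"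
      by (simp add: singular_value_def singular_values_def G_def[symmetric] pr t_def nth_map assms)
    moreover have "min (e r) (e s) \<le> t"
      unfolding t_def by (rule sorted_list_second_largest) (simp_all only: sub, simp_all)
    then have "min (norm (a r)) (norm (a s)) \<le> sqrt t"
      unfolding e2 a_def by (auto simp: min_def real_le_rsqrt split: if_splits)
    moreover have m: "max (norm (a r)) (norm (a s)) \<le> entry_sum A"
      using norm_mult_le_entry_sum[of A "q r"] norm_mult_le_entry_sum[of A "q s"]
      by (simp add: nq a_def)
    moreover have "norm (a r) * norm (a s) = max (norm (a r)) (norm (a s)) * min (norm (a r)) (norm (a s))"
      by (simp add: max_def min_def)
    moreover have "max (norm (a r)) (norm (a s)) * min (norm (a r)) (norm (a s)) \<le> entry_sum A * sqrt t"
      by (rule mult_mono) (use calculation entry_sum_nonneg in auto)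
    ultimately show ?thesis by simp
  qed
  have dec: "A $ i $ k = (\<Sum>r\<in>UNIV. a r $ i * q r $ k)" for i k
  proof -
    define Q :: "real ^ 'n ^ 'n" where "Q = (\<chi> i j. q j $ i)"
    have "transpose Q ** Q = mat 1"
      using q by (simp add: Q_def matrix_matrix_mult_def transpose_def mat_def vec_eq_iff inner_vec_def)
    then have "A ** Q ** transpose Q = A"
      by (metis matrix_left_right_inverse matrix_mul_assoc matrix_mul_rid)
    then have "A $ i $ k = (A ** Q ** transpose Q) $ i $ k" by simp
    then show ?thesis
      by (simp add: matrix_matrix_mult_def[of "A ** Q"] transpose_def Q_def a_def)
         (simp add: matrix_matrix_mult_def matrix_vector_mult_def)
  qed
  have bd: "\<bar>a r $ i * q r $ k\<bar> \<le> norm (a r)" for r i k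
    using mult_mono[OF component_le_norm_cart[of "a r" i] component_le_norm_cart[of "q r" k]]
    by (simp add: nq abs_mult)
  have tm: "\<bar>a r $ i * q r $ k * (a s $ j * q s $ l) - a r $ i * q r $ l * (a s $ j * q s $ k)\<bar>
      \<le> 2 * (entry_sum A * singular_value 2 A)" for r s
  proof (cases "r = s")
    case True
    \<comment> \<open>For \<open>r = s\<close> the two products cancel and only nonnegativity of the
      bound is left; it comes from \<open>small\<close> with a second index, available because
      \<open>CARD('n) \<ge> 2\<close>.\<close>
    have "\<exists>s'. s' \<noteq> r"
    proof (rule ccontr)
      assume "\<nexists>s'. s' \<noteq> r"
      then have "(UNIV :: 'n set) = {r}" by auto
      then have "CARD('n) = card {r}" by (rule arg_cong)
      then show False using assms by simp
    qed
    then show ?thesis using small True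
      by (auto intro: order_trans[OF mult_nonneg_nonneg[OF norm_ge_zero norm_ge_zero]])
  next
    case False
    have "\<bar>a r $ i * q r $ k * (a s $ j * q s $ l)\<bar> \<le> norm (a r) * norm (a s)"
      "\<bar>a r $ i * q r $ l * (a s $ j * q s $ k)\<bar> \<le> norm (a r) * norm (a s)"
      unfolding abs_mult[of "a r $ i * _"] by (intro mult_mono bd; simp)+
    then show ?thesis using small[OF False] by linarith
  qed
  have "minor A i j k l = (\<Sum>r\<in>UNIV. \<Sum>s\<in>UNIV. a r $ i * q r $ k * (a s $ j * q s $ l)
      - a r $ i * q r $ l * (a s $ j * q s $ k))"
    by (simp add: minor_def dec sum_product sum_subtractf)
  also have "\<bar>\<dots>\<bar> \<le> (\<Sum>r\<in>(UNIV::'n set). \<Sum>s\<in>(UNIV::'n set). 2 * (entry_sum A * singular_value 2 A))"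
    by (intro order_trans[OF sum_abs] sum_mono tm)
  also have "\<dots> = 2 * (real CARD('n))\<^sup>2 * entry_sum A * singular_value 2 A"
    by (simp add: power2_eq_square)
  finally show ?thesis .
qed

section \<open>Convergence of the columns\<close>

text \<open>A norm is convex, hence continuous in finite dimension, and therefore has a positive
  minimum \<open>N X\<close> on the Euclidean unit sphere. The constant is the number of entries
  divided by that minimum.\<close>

lemma entry_sum_le_matrix_norm:
  fixes N :: "real ^ 'n ^ 'n \<Rightarrow> real"
  assumes "is_matrix_norm N"
  obtains c where "c > 0" "\<And>A. entry_sum A \<le> c * N A"
proof -
  have N: "\<And>A. N A = 0 \<longleftrightarrow> A = 0" "\<And>c A. N (c *\<^sub>R A) = \<bar>c\<bar> * N A"
    "\<And>A B. N (A + B) \<le> N A + N B"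
    using assms by (auto simp: is_matrix_norm_def)
  have N0: "0 \<le> N A" for A
    using N(3)[of A "- A"] N(1)[of 0] N(2)[of "- 1" A] by simp
  have "convex_on UNIV N"
    unfolding convex_on_def using N(2,3) by (auto intro: order_trans[OF N(3)])
  then have "continuous_on UNIV N"
    by (rule convex_on_continuous[OF open_UNIV])
  then have "continuous_on (sphere 0 1) N"
    by (rule continuous_on_subset) simp
  moreover have "sphere (0 :: real ^ 'n ^ 'n) 1 \<noteq> {}"
    by simp
  ultimately obtain X where X: "norm X = 1" "\<And>A. norm A = 1 \<Longrightarrow> N X \<le> N A"
    using continuous_attains_inf[of "sphere 0 1" N] by auto
  have "N X \<noteq> 0" using N(1)[of X] X(1) by auto
  with N0[of X] have NX: "N X > 0" by simp
  have nb: "norm A * N X \<le> N A" for A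
  proof (cases "A = 0")
    case False
    have "N X \<le> N ((1 / norm A) *\<^sub>R A)" using False by (intro X(2)) simp
    then show ?thesis using False by (simp add: N(2) field_simps)
  qed (use N0 in simp)
  have "entry_sum A \<le> (real CARD('n))\<^sup>2 * norm A" for A :: "real ^ 'n ^ 'n"
  proof -
    have "\<bar>A $ i $ j\<bar> \<le> norm A" for i j
      using component_le_norm_cart[of "A $ i" j] Finite_Cartesian_Product.norm_nth_le[of A i] by linarith
    then have "entry_sum A \<le> (\<Sum>i\<in>(UNIV :: 'n set). \<Sum>j\<in>(UNIV :: 'n set). norm A)"
      unfolding entry_sum_def by (intro sum_mono)
    then show ?thesis by (simp add: power2_eq_square mult.assoc)
  qed
  then have "entry_sum A \<le> ((real CARD('n))\<^sup>2 / N X) * N A" for A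
    using order_trans[OF _ mult_left_mono[OF nb[of A], of "(real CARD('n))\<^sup>2 / N X"]] NX
    by (fastforce simp: field_simps)
  moreover have "(real CARD('n))\<^sup>2 / N X > 0" using NX by simp
  ultimately show ?thesis using that by blast
qed

section \<open>Products of nonnegative unimodular integer matrices\<close>

lemma mprod_same [simp]: "n \<le> m \<Longrightarrow> mprod M m n = mat 1"
  by (simp add: mprod_def)

lemma mprod_Suc:
  assumes "m \<le> n"
  shows "mprod M m (n + 1) = mprod M m n ** M n"
proof -
  have fold: "foldr (\<lambda>k A. M k ** A) ks B = foldr (\<lambda>k A. M k ** A) ks (mat 1) ** B" for ks B
    by (induction ks) (simp_all add: matrix_mul_assoc)
  have "[m..n] = [m..n - 1] @ [n]" using assms by (rule upto_rec2)
  then show ?thesis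
    by (simp add: mprod_def) (rule fold)
qed

lemma mprod_split:
  assumes "m \<le> k" "k \<le> n"
  shows "mprod M m n = mprod M m k ** mprod M k n"
  using assms(2)
proof (induction n rule: int_ge_induct)
  case (step i)
  then show ?case using assms(1) by (simp add: mprod_Suc matrix_mul_assoc)
qed simp

lemma nonneg_unimodular_mult:
  "A \<in> nonneg_unimodular \<Longrightarrow> B \<in> nonneg_unimodular \<Longrightarrow> A ** B \<in> nonneg_unimodular"
proof -
  assume *: "A \<in> nonneg_unimodular" "B \<in> nonneg_unimodular"
  then have "0 \<le> (A ** B) $ i $ j" for i j
    by (auto simp: nonneg_unimodular_def matrix_matrix_mult_def intro!: sum_nonneg)
  then show ?thesis using * by (auto simp: nonneg_unimodular_def det_mul)
qed

lemma mat_1_nonneg_unimodular: "mat 1 \<in> nonneg_unimodular"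
  unfolding nonneg_unimodular_def by simp (simp add: mat_def)

lemma mprod_nonneg_unimodular:
  assumes "\<And>n. M n \<in> nonneg_unimodular"
  shows "mprod M m n \<in> nonneg_unimodular"
proof (cases "m \<le> n")
  case True
  then show ?thesis
  proof (induction n rule: int_ge_induct)
    case base
    show ?case by (simp add: mat_1_nonneg_unimodular)
  next
    case (step i)
    then show ?case by (simp add: mprod_Suc nonneg_unimodular_mult assms)
  qed
next
  case False
  then show ?thesis by (simp add: mat_1_nonneg_unimodular)
qed

lemma of_int_mat_mult: "of_int_mat (A ** B) = of_int_mat A ** of_int_mat B"
  by (rule map_matrix_mult) auto

lemma of_int_mat_1: "of_int_mat (mat 1) = mat 1"
  by (simp add: vec_eq_iff mat_def)

lemma det_of_int_mat: "det (of_int_mat A) = of_int (det A)"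
  by (rule det_map_matrix) auto

text \<open>A zero row would make the determinant vanish, and a nonzero row of nonnegative integers
  sums to at least 1. This keeps the entry sums of the products from decreasing.\<close>

lemma nonneg_unimodular_row_sum:
  assumes "A \<in> nonneg_unimodular"
  shows "1 \<le> (\<Sum>j\<in>UNIV. A $ i $ j)"
proof -
  have "row i A \<noteq> 0" using assms det_zero_row(1)[of i A] by (auto simp: nonneg_unimodular_def)
  then obtain j where "A $ i $ j \<noteq> 0" by (auto simp: row_def vec_eq_iff)
  then have "1 \<le> A $ i $ j" using assms by (auto simp: nonneg_unimodular_def order_less_le int_one_le_iff_zero_less)
  also have "\<dots> \<le> (\<Sum>j\<in>UNIV. A $ i $ j)"
    using assms by (intro member_le_sum) (auto simp: nonneg_unimodular_def)
  finally show ?thesis .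
qed

lemma nonneg_unimodular_column_sum:
  assumes "A \<in> nonneg_unimodular"
  shows "1 \<le> (\<Sum>i\<in>UNIV. A $ i $ j)"
  using nonneg_unimodular_row_sum[of "transpose A" j] assms
  by (auto simp: nonneg_unimodular_def) (auto simp: transpose_def)

text \<open>Expanding only the rows of the left factor gives a Cauchy-Binet formula over all ordered
  pairs \<open>r\<close>, \<open>s\<close>. It serves to change the left end of a product by a fixed
  matrix.\<close>

lemma minor_matrix_mult_bound:
  fixes A B :: "real ^ 'n ^ 'n"
  assumes "\<And>i j k l. \<bar>minor B i j k l\<bar> \<le> b"
  shows "\<bar>minor (A ** B) i j k l\<bar> \<le> (entry_sum A)\<^sup>2 * b"
proof -
  have b: "0 \<le> b" using assms by (meson abs_ge_zero order_trans)
  have row: "(\<Sum>r\<in>UNIV. \<bar>A $ i $ r\<bar>) \<le> entry_sum A" for i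
    unfolding entry_sum_def
    by (rule member_le_sum[of i UNIV "\<lambda>i. \<Sum>j\<in>UNIV. \<bar>A $ i $ j\<bar>"]) (auto intro: sum_nonneg)
  have "minor (A ** B) i j k l = (\<Sum>r\<in>UNIV. \<Sum>s\<in>UNIV. A $ i $ r * A $ j $ s * minor B r s k l)"
    by (simp add: minor_def matrix_matrix_mult_def sum_product sum_subtractf[symmetric] algebra_simps)
  also have "\<bar>\<dots>\<bar> \<le> (\<Sum>r\<in>UNIV. \<Sum>s\<in>UNIV. \<bar>A $ i $ r\<bar> * \<bar>A $ j $ s\<bar> * b)"
    by (intro order_trans[OF sum_abs] sum_mono) (auto simp: abs_mult intro!: mult_left_mono assms)
  also have "\<dots> = (\<Sum>r\<in>UNIV. \<bar>A $ i $ r\<bar>) * (\<Sum>r\<in>UNIV. \<bar>A $ j $ r\<bar>) * b"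
    unfolding sum_product by (simp only: sum_distrib_right)
  also have "\<dots> \<le> entry_sum A * entry_sum A * b"
    by (intro mult_right_mono mult_mono row b) (auto intro: sum_nonneg entry_sum_nonneg)
  finally show ?thesis by (simp add: power2_eq_square)
qed

lemma entry_sum_mult: "entry_sum (A ** B) \<le> entry_sum A * entry_sum B"
  for A :: "real ^ 'm ^ 'n" and B :: "real ^ 'k ^ 'm"
proof -
  have row: "(\<Sum>r\<in>UNIV. \<bar>B $ i $ r\<bar>) \<le> entry_sum B" for i
    unfolding entry_sum_def
    by (rule member_le_sum[of i UNIV "\<lambda>i. \<Sum>j\<in>UNIV. \<bar>B $ i $ j\<bar>"]) (auto intro: sum_nonneg)
  have "entry_sum (A ** B) \<le> (\<Sum>i\<in>UNIV. \<Sum>j\<in>UNIV. \<Sum>k\<in>UNIV. \<bar>A $ i $ k\<bar> * \<bar>B $ k $ j\<bar>)"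
    unfolding entry_sum_def matrix_matrix_mult_def
    by (intro sum_mono) (simp add: abs_mult[symmetric] sum_abs)
  also have "\<dots> = (\<Sum>i\<in>UNIV. \<Sum>k\<in>UNIV. \<bar>A $ i $ k\<bar> * (\<Sum>j\<in>UNIV. \<bar>B $ k $ j\<bar>))"
    by (subst sum.swap) (simp add: sum_distrib_left)
  also have "\<dots> \<le> (\<Sum>i\<in>UNIV. \<Sum>k\<in>UNIV. \<bar>A $ i $ k\<bar> * entry_sum B)"
    by (intro sum_mono mult_left_mono row) auto
  also have "\<dots> = entry_sum A * entry_sum B"
    by (simp add: entry_sum_def[of A] sum_distrib_right)
  finally show ?thesis .
qed

text \<open>
  Two vectors \<open>x\<close>, \<open>y\<close> with coordinate sum 1 satisfy
  \<open>x\<^sub>i - y\<^sub>i = (\<Sum>j. x\<^sub>i y\<^sub>j - x\<^sub>j y\<^sub>i)\<close>, so minors control the distance between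
  normalised columns.
\<close>

lemma columns_converge:
  fixes P A :: "nat \<Rightarrow> real ^ 'n ^ 'n" and C \<beta> :: real
  assumes \<beta>: "0 < \<beta>" "\<beta> < 1"
    and P0: "P 0 = mat 1" and PS: "\<And>n. P (Suc n) = P n ** A n"
    and A0: "\<And>n i j. 0 \<le> A n $ i $ j" and A1: "\<And>n i. 1 \<le> (\<Sum>j\<in>UNIV. A n $ i $ j)"
    and minors: "\<And>n i j k l. \<bar>minor (P n) i j k l\<bar> * entry_sum (A n) \<le> C * \<beta> ^ n * entry_sum (P n)"
  obtains u K where "\<And>i. 0 \<le> u $ i" "(\<Sum>i\<in>UNIV. u $ i) = 1" "K > 0"
    "\<And>n i j. \<bar>P n $ i $ j - (\<Sum>k\<in>UNIV. P n $ k $ j) * u $ i\<bar> \<le> K * \<beta> ^ n"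
proof -
  define d where "d = real CARD('n)"
  have d: "d \<ge> 1" by (simp add: d_def Suc_le_eq)
  \<comment> \<open>\<open>r n\<close> and \<open>v n\<close> are \<open>A n\<close> and
    \<open>P n\<close> applied to the all-ones vector, so that \<open>v (Suc n)\<close> is
    \<open>P n\<close> applied to \<open>r n\<close>; \<open>w n\<close> is \<open>v n\<close>
    scaled to coordinate sum 1.\<close>
  define r where "r n k = (\<Sum>j\<in>UNIV. A n $ k $ j)" for n k
  define v where "v n i = (\<Sum>j\<in>UNIV. P n $ i $ j)" for n i
  define s where "s n = (\<Sum>i\<in>UNIV. v n i)" for n
  define w where "w n i = v n i / s n" for n i
  define m where "m n = C * \<beta> ^ n * s n" for n
  have Pn: "0 \<le> P n $ i $ j" for n i j
  proof (induction n arbitrary: i j)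
    case 0
    show ?case by (simp add: P0 mat_def)
  next
    case (Suc n)
    then show ?case by (auto simp: PS matrix_matrix_mult_def A0 intro!: sum_nonneg)
  qed
  have sP: "entry_sum (P n) = s n" for n
    by (simp add: entry_sum_def s_def v_def Pn)
  have rA: "(\<Sum>k\<in>UNIV. r n k) = entry_sum (A n)" for n
    by (simp add: entry_sum_def r_def A0)
  have vS: "v (Suc n) i = (\<Sum>k\<in>UNIV. P n $ i $ k * r n k)" for n i
    unfolding v_def PS matrix_matrix_mult_def r_def
    by simp (subst sum.swap, simp add: sum_distrib_left)
  have v0: "0 \<le> v n i" for n i by (simp add: v_def Pn sum_nonneg)
  have r1: "1 \<le> r n k" for n k using A1 by (simp add: r_def)
  have "P n $ i $ k \<le> P n $ i $ k * r n k" for n i k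
    using mult_left_mono[OF r1 Pn] by simp
  then have "v n i \<le> v (Suc n) i" for n i
    unfolding vS by (simp add: v_def sum_mono)
  then have smono: "s n \<le> s (Suc n)" for n unfolding s_def by (intro sum_mono)
  have "s 0 = d"
    by (simp add: s_def v_def P0 mat_def d_def)
  then have s1: "1 \<le> s n" for n
  proof (induction n)
    case (Suc n)
    then show ?case using smono[of n] by linarith
  qed (use d in simp)
  have sinc: "s n \<le> s (n + k)" for n k
    by (rule lift_Suc_mono_le[of s]) (auto intro: smono)
  have wsum: "(\<Sum>i\<in>UNIV. w n i) = 1" for n
    using s1[of n] by (simp add: w_def sum_divide_distrib[symmetric] s_def[symmetric])
  have eA1: "1 \<le> entry_sum (A n)" for n
    unfolding rA[symmetric] using member_le_sum[of undefined UNIV "r n"] r1[of n]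
    by (metis UNIV_I finite order_trans zero_le_one)
  have mA: "\<bar>minor (P n) i j k l\<bar> * entry_sum (A n) \<le> m n" for n i j k l
    using minors by (simp add: m_def sP)
  have m1: "\<bar>minor (P n) i j k l\<bar> \<le> m n" for n i j k l
    using mA[of n i j k l] mult_left_mono[OF eA1[of n], of "\<bar>minor (P n) i j k l\<bar>"] by simp
  have m0: "0 \<le> m n" for n using m1 by (meson abs_ge_zero order_trans)
  have C0: "0 \<le> C" using m0[of 0] s1[of 0] by (simp add: m_def zero_le_mult_iff)
  \<comment> \<open>Both vectors are images under \<open>P n\<close>, so their cross products are
    combinations of minors with total weight \<open>d * entry_sum (A n)\<close>. The factor
    \<open>entry_sum (A n)\<close> in the hypothesis on minors cancels against this weight.\<close>
  have cross: "\<bar>v (Suc n) i * v n j - v (Suc n) j * v n i\<bar> \<le> d * m n" for n i j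
  proof -
    have "v (Suc n) i * v n j - v (Suc n) j * v n i
        = (\<Sum>k\<in>UNIV. \<Sum>l\<in>UNIV. r n k * minor (P n) i j k l)"
      unfolding vS unfolding v_def sum_product
      by (simp add: sum_subtractf[symmetric] minor_def algebra_simps)
    also have "\<bar>\<dots>\<bar> \<le> (\<Sum>k\<in>UNIV. \<Sum>l\<in>(UNIV :: 'n set). r n k * (m n / entry_sum (A n)))"
    proof (intro order_trans[OF sum_abs] sum_mono)
      fix k l
      have "\<bar>minor (P n) i j k l\<bar> \<le> m n / entry_sum (A n)"
        using mA[of n i j k l] eA1[of n] by (simp add: field_simps)
      then show "\<bar>r n k * minor (P n) i j k l\<bar> \<le> r n k * (m n / entry_sum (A n))"
        using r1[of n k] by (simp add: abs_mult mult_left_mono del: times_divide_eq_right)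
    qed
    also have "\<dots> = (\<Sum>k\<in>UNIV. r n k) * d * (m n / entry_sum (A n))"
      by (simp add: sum_distrib_left[symmetric] sum_divide_distrib[symmetric] d_def mult_ac)
    also have "\<dots> = d * m n" using eA1[of n] by (simp add: rA)
    finally show ?thesis .
  qed
  \<comment> \<open>\<open>m n\<close> contains the factor \<open>s n\<close>, which cancels one of
    the two denominators; the other one is kept.\<close>
  have step: "\<bar>w (Suc n) i - w n i\<bar> \<le> d\<^sup>2 * C * \<beta> ^ n / s (Suc n)" for n i
  proof -
    have "w (Suc n) i - w n i = (\<Sum>j\<in>UNIV. w (Suc n) i * w n j - w (Suc n) j * w n i)"
      using wsum by (simp add: sum_subtractf sum_distrib_left[symmetric] sum_distrib_right[symmetric])
    also have "\<dots> = (\<Sum>j\<in>UNIV. (v (Suc n) i * v n j - v (Suc n) j * v n i) / (s (Suc n) * s n))"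
      by (simp add: w_def diff_divide_distrib)
    also have "\<bar>\<dots>\<bar> \<le> (\<Sum>j\<in>(UNIV :: 'n set). d * m n / (s (Suc n) * s n))"
      using s1[of n] s1[of "Suc n"]
      by (intro order_trans[OF sum_abs] sum_mono) (auto simp: abs_mult intro!: divide_right_mono cross)
    also have "\<dots> = d\<^sup>2 * C * \<beta> ^ n / s (Suc n)"
      using s1[of n] by (simp add: m_def d_def power2_eq_square)
    finally show ?thesis .
  qed
  define L where "L = d\<^sup>2 * C / (1 - \<beta>)"
  have L0: "0 \<le> L" using C0 \<beta> by (simp add: L_def)
  \<comment> \<open>Telescoping with a geometric series, whose sum is the origin of
    \<open>L\<close>. Since \<open>s\<close> is nondecreasing, a factor \<open>1 / s n\<close> comes
    out of the sum, and the limit inherits it in \<open>wu\<close>.\<close>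
  have far: "\<bar>w (n + k) i - w n i\<bar> \<le> L * \<beta> ^ n / s n" for n k i
  proof -
    have "\<bar>w (n + k) i - w n i\<bar> \<le> d\<^sup>2 * C * (\<Sum>j<k. \<beta> ^ (n + j)) / s n"
    proof (induction k)
      case (Suc k)
      have "\<bar>w (Suc (n + k)) i - w (n + k) i\<bar> \<le> d\<^sup>2 * C * \<beta> ^ (n + k) / s (Suc (n + k))"
        by (rule step)
      also have "\<dots> \<le> d\<^sup>2 * C * \<beta> ^ (n + k) / s n"
        using s1[of n] sinc[of n "Suc k"] C0 \<beta> by (intro divide_left_mono) auto
      finally show ?case using Suc by (simp add: algebra_simps add_divide_distrib)
    qed simp
    also have "(\<Sum>j<k. \<beta> ^ (n + j)) = \<beta> ^ n * (\<Sum>j<k. \<beta> ^ j)"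
      by (simp add: power_add sum_distrib_left)
    also have "(\<Sum>j<k. \<beta> ^ j) = (1 - \<beta> ^ k) / (1 - \<beta>)"
      using \<beta> by (simp add: sum_gp_strict)
    also have "d\<^sup>2 * C * (\<beta> ^ n * ((1 - \<beta> ^ k) / (1 - \<beta>))) / s n = (L * \<beta> ^ n / s n) * (1 - \<beta> ^ k)"
      by (simp add: L_def)
    also have "\<dots> \<le> L * \<beta> ^ n / s n"
      using L0 s1[of n] \<beta> by (intro mult_right_le_one_le) (auto simp: power_le_one)
    finally show ?thesis by simp
  qed
  have \<beta>0: "(\<lambda>n. K * \<beta> ^ n) \<longlonglongrightarrow> 0" for K
    using \<beta> by (intro tendsto_mult_right_zero LIMSEQ_realpow_zero) auto
  have far': "\<bar>w (n + k) i - w n i\<bar> \<le> L * \<beta> ^ n" for n k i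
  proof -
    have "L * \<beta> ^ n / s n \<le> L * \<beta> ^ n / 1"
      using s1[of n] L0 \<beta> by (intro divide_left_mono) auto
    then show ?thesis using far[of n k i] by simp
  qed
  have "Cauchy (\<lambda>n. w n i)" for i
    unfolding Cauchy_altdef
  proof (intro allI impI)
    fix e :: real
    assume "0 < e"
    then obtain n0 where n0: "\<And>n. n \<ge> n0 \<Longrightarrow> L * \<beta> ^ n < e"
      using order_tendstoD(2)[OF \<beta>0[of L]] by (auto simp: eventually_sequentially)
    have "dist (w n i) (w k i) < e" if "n \<ge> n0" "k > n" for n k
      using far'[of n "k - n" i] n0[OF that(1)] that(2) by (simp add: dist_real_def)
    then show "\<exists>n0. \<forall>n\<ge>n0. \<forall>k>n. dist (w n i) (w k i) < e" by blast
  qed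
  then have "\<exists>l. (\<lambda>n. w n i) \<longlonglongrightarrow> l" for i
    by (simp add: Cauchy_convergent_iff convergent_def)
  then obtain l where l: "\<And>i. (\<lambda>n. w n i) \<longlonglongrightarrow> l i" by metis
  define u :: "real ^ 'n" where "u = (\<chi> i. l i)"
  have wu: "\<bar>u $ i - w n i\<bar> \<le> L * \<beta> ^ n / s n" for n i
  proof (rule tendsto_upperbound)
    show "(\<lambda>k. \<bar>w (n + k) i - w n i\<bar>) \<longlonglongrightarrow> \<bar>u $ i - w n i\<bar>"
      using LIMSEQ_ignore_initial_segment[OF l[of i], of n]
      by (intro tendsto_intros) (simp add: u_def add.commute)
  qed (use far in auto)
  have "0 \<le> w n i" for n i
    using v0[of n i] s1[of n] by (simp add: w_def)
  then have u0: "0 \<le> u $ i" for i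
    unfolding u_def by (simp add: LIMSEQ_le_const[OF l])
  have "(\<lambda>n. \<Sum>i\<in>UNIV. w n i) \<longlonglongrightarrow> (\<Sum>i\<in>UNIV. l i)"
    by (intro tendsto_sum l)
  then have u1: "(\<Sum>i\<in>UNIV. u $ i) = 1"
    using wsum by (simp add: u_def LIMSEQ_const_iff)
  \<comment> \<open>The column is compared with \<open>c * w n\<close>, and this with
    \<open>c * u\<close>. The first error is a sum of minors over \<open>s n\<close>, giving
    \<open>d\<^sup>2 * C\<close>; in the second, \<open>c \<le> s n\<close> cancels the denominator
    of \<open>wu\<close>, giving \<open>L\<close>. The summand 1 makes the constant
    positive.\<close>
  have close: "\<bar>P n $ i $ j - (\<Sum>k\<in>UNIV. P n $ k $ j) * u $ i\<bar> \<le> (d\<^sup>2 * C + L + 1) * \<beta> ^ n" for n i j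
  proof -
    define c where "c = (\<Sum>k\<in>UNIV. P n $ k $ j)"
    have c: "0 \<le> c" "c \<le> s n"
    proof -
      show "0 \<le> c" by (simp add: c_def Pn sum_nonneg)
      have "P n $ k $ j \<le> v n k" for k
        unfolding v_def by (rule member_le_sum) (auto simp: Pn)
      then show "c \<le> s n" unfolding c_def s_def by (intro sum_mono)
    qed
    have "P n $ i $ j - c * w n i = (\<Sum>k\<in>UNIV. P n $ i $ j * v n k - P n $ k $ j * v n i) / s n"
      using s1[of n]
      by (simp add: sum_subtractf sum_distrib_left[symmetric] sum_distrib_right[symmetric]
          c_def[symmetric] s_def[symmetric] w_def field_simps)
    also have "(\<Sum>k\<in>UNIV. P n $ i $ j * v n k - P n $ k $ j * v n i)
        = (\<Sum>k\<in>UNIV. \<Sum>l\<in>UNIV. minor (P n) i k j l)"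
      by (simp add: v_def minor_def sum_distrib_left sum_subtractf[symmetric] mult_ac)
    also have "\<bar>\<dots> / s n\<bar> \<le> (\<Sum>k\<in>(UNIV :: 'n set). \<Sum>l\<in>(UNIV :: 'n set). m n) / s n"
    proof -
      have "\<bar>\<Sum>k\<in>UNIV. \<Sum>l\<in>UNIV. minor (P n) i k j l\<bar> \<le> (\<Sum>k\<in>(UNIV :: 'n set). \<Sum>l\<in>(UNIV :: 'n set). m n)"
        by (intro order_trans[OF sum_abs] sum_mono m1)
      then show ?thesis using s1[of n] by (simp only: abs_divide) (simp add: divide_right_mono)
    qed
    also have "\<dots> = d\<^sup>2 * C * \<beta> ^ n"
      using s1[of n] by (simp add: m_def d_def power2_eq_square)
    finally have 1: "\<bar>P n $ i $ j - c * w n i\<bar> \<le> d\<^sup>2 * C * \<beta> ^ n" .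
    have "\<bar>c * w n i - c * u $ i\<bar> = c * \<bar>u $ i - w n i\<bar>"
      using c by (simp add: abs_mult right_diff_distrib[symmetric] abs_minus_commute)
    also have "\<dots> \<le> s n * (L * \<beta> ^ n / s n)"
      using c wu[of i n] s1[of n] by (intro mult_mono) auto
    also have "\<dots> = L * \<beta> ^ n" using s1[of n] by simp
    finally have "\<bar>P n $ i $ j - c * u $ i\<bar> \<le> (d\<^sup>2 * C + L) * \<beta> ^ n"
      using 1 unfolding distrib_right by linarith
    also have "\<dots> \<le> (d\<^sup>2 * C + L + 1) * \<beta> ^ n" using \<beta> by (intro mult_right_mono) auto
    finally show ?thesis by (simp add: c_def)
  qed
  have "d\<^sup>2 * C + L + 1 > 0" using C0 L0 by (simp add: add_nonneg_pos)
  then show ?thesis using that[of u, OF u0 u1 _ close] by blast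
qed

lemma entry_sum_of_nonneg_unimodular:
  assumes "A \<in> nonneg_unimodular"
  shows "1 \<le> entry_sum (of_int_mat A)"
proof -
  have "1 \<le> (\<Sum>j\<in>UNIV. A $ undefined $ j)" by (rule nonneg_unimodular_row_sum[OF assms])
  then have "1 \<le> (\<Sum>j\<in>UNIV. real_of_int (A $ undefined $ j))" by (metis of_int_1_le_iff of_int_sum)
  also have "\<dots> = (\<Sum>j\<in>UNIV. \<bar>of_int_mat A $ undefined $ j\<bar>)"
    using assms by (intro sum.cong) (auto simp: nonneg_unimodular_def)
  also have "\<dots> \<le> entry_sum (of_int_mat A)"
    unfolding entry_sum_def
    by (rule member_le_sum[of undefined UNIV "\<lambda>i. \<Sum>j\<in>UNIV. \<bar>of_int_mat A $ i $ j\<bar>"]) (auto intro: sum_nonneg)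
  finally show ?thesis .
qed

lemma minor_le_entry_sum: "\<bar>minor A i j k l\<bar> \<le> 2 * (entry_sum A)\<^sup>2"
  for A :: "real ^ 'm ^ 'n"
proof -
  have "\<bar>A $ i $ k * A $ j $ l\<bar> \<le> entry_sum A * entry_sum A" for i j k l
    unfolding abs_mult by (intro mult_mono abs_le_entry_sum entry_sum_nonneg abs_ge_zero)
  from this[of i k j l] this[of i l j k] show ?thesis
    by (simp add: minor_def power2_eq_square)
qed

text \<open>A number \<open>z < 0\<close> above the limit superior is split in halves:
  \<open>exp (z * n)\<close> bounds the second singular value, the growth condition keeps the norm
  of \<open>M n\<close> below \<open>exp (- z / 2 * n)\<close>, and \<open>exp (z / 2)\<close>
  remains as \<open>\<beta>\<close>. All this holds for large \<open>n\<close>; the finitely many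
  others are absorbed by \<open>C\<close>.\<close>

lemma mprod_minors_decay:
  fixes M :: "int \<Rightarrow> int ^ 'd ^ 'd"
  assumes d: "CARD('d) \<ge> 2" and M: "\<And>n. M n \<in> nonneg_unimodular" and N: "is_matrix_norm N"
    and pisot: "local_Pisot M" and growth: "growth_condition N M"
  obtains \<beta> C where "0 < \<beta>" "\<beta> < 1"
    "\<And>n i j k l. \<bar>minor (of_int_mat (mprod M 0 (int n))) i j k l\<bar> * entry_sum (of_int_mat (M (int n)))
        \<le> C * \<beta> ^ n * entry_sum (of_int_mat (mprod M 0 (int n)))"
proof -
  define P where "P n = (of_int_mat (mprod M 0 (int n)) :: real ^ 'd ^ 'd)" for n
  define A where "A n = (of_int_mat (M (int n)) :: real ^ 'd ^ 'd)" for n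
  define \<sigma> where "\<sigma> n = singular_value 2 (P n)" for n
  have P1: "1 \<le> entry_sum (P n)" for n
    unfolding P_def by (intro entry_sum_of_nonneg_unimodular mprod_nonneg_unimodular M)
  obtain c where c: "c > 0" "\<And>X. entry_sum X \<le> c * N X"
    using entry_sum_le_matrix_norm[OF N] by blast
  have "limsup (\<lambda>n. ereal (1 / real n * ln (\<sigma> n))) < 0"
    using pisot by (simp add: local_Pisot_def P_def \<sigma>_def)
  then obtain z where z: "limsup (\<lambda>n. ereal (1 / real n * ln (\<sigma> n))) < ereal z" "z < 0"
    using ereal_dense2[of _ 0] by auto
  have e1: "\<forall>\<^sub>F n in sequentially. ereal (1 / real n * ln (\<sigma> n)) < ereal z"
    using z(1) by (rule Limsup_lessD)
  have e2: "\<forall>\<^sub>F n in sequentially. 1 / real n * ln (N (A n)) < - z / 2"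
    using growth z(2) by (intro order_tendstoD(2)[of _ 0]) (auto simp: growth_condition_def A_def)
  define \<beta> where "\<beta> = exp (z / 2)"
  have \<beta>: "0 < \<beta>" "\<beta> < 1" using z(2) by (auto simp: \<beta>_def)
  \<comment> \<open>For \<open>x \<le> 0\<close> the bound holds because the exponential is
    positive, so the value that \<open>ln\<close> takes there does not matter.\<close>
  have expb: "x \<le> exp (y * real n)" if "1 / real n * ln x < y" "n > 0" for x y :: real and n
  proof (cases "x > 0")
    case True
    have "ln x \<le> y * real n" using that by (simp add: field_simps)
    then show ?thesis using True by (metis exp_ln exp_le_cancel_iff)
  next
    case False
    then show ?thesis using exp_gt_zero[of "y * real n"] by linarith
  qed
  define K where "K = 2 * (real CARD('d))\<^sup>2 * c"
  have K: "K > 0" using c by (simp add: K_def)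
  have "\<forall>\<^sub>F n in sequentially. \<forall>i j k l.
      \<bar>minor (P n) i j k l\<bar> * entry_sum (A n) \<le> K * \<beta> ^ n * entry_sum (P n)"
    using e1 e2 eventually_gt_at_top[of 0]
  proof eventually_elim
    case (elim n)
    have s: "\<sigma> n \<le> exp (z * real n)" and t: "N (A n) \<le> exp (- z / 2 * real n)"
      using elim expb[of n "\<sigma> n" z] expb[of n "N (A n)" "- z / 2"] by auto
    show ?case
    proof (intro allI)
      fix i j k l
      have "\<bar>minor (P n) i j k l\<bar> \<le> 2 * (real CARD('d))\<^sup>2 * entry_sum (P n) * \<sigma> n"
        unfolding \<sigma>_def by (rule minor_le_singular_value_2[OF d])
      also have "\<dots> \<le> 2 * (real CARD('d))\<^sup>2 * entry_sum (P n) * exp (z * real n)"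
        by (intro mult_left_mono s) (simp add: entry_sum_nonneg)
      finally have 1: "\<bar>minor (P n) i j k l\<bar> \<le> 2 * (real CARD('d))\<^sup>2 * entry_sum (P n) * exp (z * real n)" .
      have 2: "entry_sum (A n) \<le> c * exp (- z / 2 * real n)"
        using c(2)[of "A n"] mult_left_mono[OF t, of c] c(1) by linarith
      have "\<bar>minor (P n) i j k l\<bar> * entry_sum (A n)
          \<le> (2 * (real CARD('d))\<^sup>2 * entry_sum (P n) * exp (z * real n)) * (c * exp (- z / 2 * real n))"
        by (intro mult_mono 1 2) (auto simp: entry_sum_nonneg)
      also have "\<dots> = K * (exp (z * real n) * exp (- z / 2 * real n)) * entry_sum (P n)"
        by (simp add: K_def)
      also have "exp (z * real n) * exp (- z / 2 * real n) = \<beta> ^ n"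
        by (simp add: \<beta>_def mult_exp_exp exp_of_nat_mult[symmetric] field_simps)
      finally show "\<bar>minor (P n) i j k l\<bar> * entry_sum (A n) \<le> K * \<beta> ^ n * entry_sum (P n)" .
    qed
  qed
  then obtain n0 where n0: "\<And>n i j k l. n \<ge> n0 \<Longrightarrow>
      \<bar>minor (P n) i j k l\<bar> * entry_sum (A n) \<le> K * \<beta> ^ n * entry_sum (P n)"
    unfolding eventually_sequentially by blast
  \<comment> \<open>\<open>F n\<close> is the trivial bound of the left side with
    \<open>\<beta> ^ n\<close> divided out; the sum over \<open>n < n0\<close> dominates each of
    them, and \<open>entry_sum (P n) \<ge> 1\<close> supplies the remaining factor.\<close>
  define F where "F n = 2 * (entry_sum (P n))\<^sup>2 * entry_sum (A n) / \<beta> ^ n" for n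
  have F0: "0 \<le> F n" for n using \<beta> by (simp add: F_def entry_sum_nonneg)
  define C where "C = K + (\<Sum>n<n0. F n)"
  have "\<bar>minor (P n) i j k l\<bar> * entry_sum (A n) \<le> C * \<beta> ^ n * entry_sum (P n)" for n i j k l
  proof (cases "n \<ge> n0")
    case True
    have "K * \<beta> ^ n * entry_sum (P n) \<le> C * \<beta> ^ n * entry_sum (P n)"
      using \<beta> F0 by (intro mult_right_mono) (auto simp: C_def sum_nonneg entry_sum_nonneg)
    with n0[OF True] show ?thesis by (rule order_trans)
  next
    case False
    have "\<bar>minor (P n) i j k l\<bar> * entry_sum (A n) \<le> 2 * (entry_sum (P n))\<^sup>2 * entry_sum (A n)"
      by (intro mult_right_mono minor_le_entry_sum entry_sum_nonneg)
    also have "\<dots> = F n * \<beta> ^ n" using \<beta> by (simp add: F_def)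
    also have "\<dots> \<le> C * \<beta> ^ n"
      using \<beta> False member_le_sum[of n "{..<n0}" F] F0 K by (intro mult_right_mono) (auto simp: C_def)
    also have "\<dots> \<le> C * \<beta> ^ n * entry_sum (P n)"
      using mult_left_mono[OF P1[of n], of "C * \<beta> ^ n"] \<beta> K F0 by (simp add: C_def sum_nonneg)
    finally show ?thesis .
  qed
  then show ?thesis using that[OF \<beta>] unfolding P_def A_def by blast
qed

lemma rationally_independent_if_integers:
  fixes u :: "real ^ 'n"
  assumes "\<And>a :: 'n \<Rightarrow> int. (\<Sum>i\<in>UNIV. of_int (a i) * u $ i) = 0 \<Longrightarrow> a = (\<lambda>_. 0)"
  shows "rationally_independent u"
  unfolding rationally_independent_def
proof (intro allI impI)
  fix c :: "'n \<Rightarrow> rat" and k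
  assume c: "(\<Sum>i\<in>UNIV. of_rat (c i) * u $ i) = 0"
  define D where "D = (\<Prod>i\<in>UNIV. snd (quotient_of (c i)))"
  have pos: "snd (quotient_of (c i)) > 0" for i by (rule quotient_of_denom_pos')
  then have D: "D > 0" by (simp add: D_def prod_pos)
  have "\<exists>a. of_int a = of_int D * c i" for i
  proof -
    have "c i = of_int (fst (quotient_of (c i))) / of_int (snd (quotient_of (c i)))"
      by (rule quotient_of_div) simp
    moreover have "D = snd (quotient_of (c i)) * (\<Prod>j\<in>UNIV - {i}. snd (quotient_of (c j)))"
      unfolding D_def by (subst prod.remove[of _ i]) auto
    ultimately have "of_int D * c i = of_int (fst (quotient_of (c i)) * (\<Prod>j\<in>UNIV - {i}. snd (quotient_of (c j))))"
      using pos[of i] by (simp add: field_simps)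
    then show ?thesis by metis
  qed
  then obtain a where a: "\<And>i. of_int (a i) = of_int D * c i" by metis
  have ar: "real_of_int (a i) = of_int D * of_rat (c i)" for i
    using arg_cong[OF a[of i], of "of_rat :: rat \<Rightarrow> real"] by (simp add: of_rat_mult)
  have "(\<Sum>i\<in>UNIV. of_int (a i) * u $ i) = of_int D * (\<Sum>i\<in>UNIV. of_rat (c i) * u $ i)"
    by (simp add: ar sum_distrib_left mult.assoc)
  then have "a = (\<lambda>_. 0)" using assms c by simp
  then show "c k = 0" using a[of k] D by simp
qed

lemma exponentially_convergent_right_eigenvector:
  fixes M :: "int \<Rightarrow> int ^ 'd ^ 'd"
  assumes M: "\<And>n. M n \<in> nonneg_unimodular" and \<beta>: "0 < \<beta>" "\<beta> < 1"
    and minors: "\<And>n i j k l. \<bar>minor (of_int_mat (mprod M 0 (int n))) i j k l\<bar> * entry_sum (of_int_mat (M (int n)))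
        \<le> C * \<beta> ^ n * entry_sum (of_int_mat (mprod M 0 (int n)))"
  obtains u where "generalized_right_eigenvector M u" "rationally_independent u"
    "converges_exponentially M u"
proof -
  define Q where "Q n = mprod M 0 (int n)" for n
  define P where "P n = (of_int_mat (Q n) :: real ^ 'd ^ 'd)" for n
  have Qu: "Q n \<in> nonneg_unimodular" for n
    unfolding Q_def by (rule mprod_nonneg_unimodular[OF M])
  have inv: "invertible (P n)" for n
    using Qu[of n] by (auto simp: invertible_det_nz P_def det_of_int_mat nonneg_unimodular_def)
  have P0: "0 \<le> P n $ i $ j" for n i j
    using Qu[of n] by (simp add: P_def nonneg_unimodular_def)
  have "P 0 = mat 1" by (simp add: P_def Q_def of_int_mat_1)
  moreover have "P (Suc n) = P n ** of_int_mat (M (int n))" for n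
    using mprod_Suc[of 0 "int n" M] by (simp add: P_def Q_def of_int_mat_mult add.commute)
  moreover have "0 \<le> (of_int_mat (M (int n)) :: real ^ 'd ^ 'd) $ i $ j" for n i j
    using M[of "int n"] by (simp add: nonneg_unimodular_def)
  moreover have "1 \<le> (\<Sum>j\<in>UNIV. (of_int_mat (M (int n)) :: real ^ 'd ^ 'd) $ i $ j)" for n i
    using nonneg_unimodular_row_sum[OF M[of "int n"], of i] by (simp flip: of_int_sum)
  ultimately obtain u K where u0: "\<And>i. 0 \<le> u $ i" and u1: "(\<Sum>i\<in>UNIV. u $ i) = 1" and K: "K > 0"
    and close: "\<And>n i j. \<bar>P n $ i $ j - (\<Sum>k\<in>UNIV. P n $ k $ j) * u $ i\<bar> \<le> K * \<beta> ^ n"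
    using columns_converge[OF \<beta>, of P "\<lambda>n. of_int_mat (M (int n))" C] minors
    unfolding P_def Q_def by blast
  define c where "c n j = (\<Sum>k\<in>UNIV. P n $ k $ j)" for n j
  have c1: "1 \<le> c n j" for n j
    using nonneg_unimodular_column_sum[OF Qu[of n], of j] by (simp add: c_def P_def flip: of_int_sum)
  have \<beta>0: "(\<lambda>n. x * \<beta> ^ n) \<longlonglongrightarrow> 0" for x
    using \<beta> by (intro tendsto_mult_right_zero LIMSEQ_realpow_zero) auto
  have unz: "u \<noteq> 0" using u1 by auto
  have ge: "generalized_right_eigenvector M u"
    unfolding generalized_right_eigenvector_def
  proof (intro conjI equalityI subsetI)
    show "u \<in> nonneg_orthant - {0}" using u0 unz by (simp add: nonneg_orthant_def)
  next
    fix x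
    assume x: "x \<in> (\<Inter>n::nat. (*v) (of_int_mat (mprod M 0 (int n))) ` nonneg_orthant)"
    define X where "X = (\<Sum>i\<in>UNIV. x $ i)"
    \<comment> \<open>The preimage \<open>y\<close> depends on \<open>n\<close>, but
      \<open>X\<close> does not. Since the column sums \<open>c n j\<close> are at least 1, the
      total weight of \<open>y\<close> is at most \<open>X\<close>, so the error tends to 0.\<close>
    have bound: "\<bar>x $ i - X * u $ i\<bar> \<le> K * X * \<beta> ^ n \<and> 0 \<le> X" for n i
    proof -
      obtain y where y: "x = P n *v y" "\<And>j. 0 \<le> y $ j"
        using x by (auto simp: P_def Q_def nonneg_orthant_def)
      have X: "X = (\<Sum>j\<in>UNIV. c n j * y $ j)"
        unfolding X_def y(1) c_def matrix_vector_mult_def sum_distrib_right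
        by simp (rule sum.swap)
      have "x $ i - X * u $ i = (\<Sum>j\<in>UNIV. (P n $ i $ j - c n j * u $ i) * y $ j)"
        unfolding X by (simp add: y(1) matrix_vector_mult_def sum_subtractf sum_distrib_left sum_distrib_right algebra_simps)
      also have "\<bar>\<dots>\<bar> \<le> (\<Sum>j\<in>UNIV. K * \<beta> ^ n * (c n j * y $ j))"
      proof (intro order_trans[OF sum_abs] sum_mono)
        fix j
        have "\<bar>(P n $ i $ j - c n j * u $ i) * y $ j\<bar> \<le> K * \<beta> ^ n * y $ j"
          using close[of n i j] y(2)[of j] by (simp add: abs_mult c_def mult_right_mono)
        also have "\<dots> \<le> K * \<beta> ^ n * (c n j * y $ j)"
          using c1[of n j] y(2)[of j] K \<beta> by (intro mult_left_mono) (auto simp: mult_le_cancel_right1)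
        finally show "\<bar>(P n $ i $ j - c n j * u $ i) * y $ j\<bar> \<le> K * \<beta> ^ n * (c n j * y $ j)" .
      qed
      also have "\<dots> = K * X * \<beta> ^ n" by (simp add: X sum_distrib_left[symmetric])
      finally show ?thesis using c1 y(2) unfolding X
        by (auto intro!: sum_nonneg mult_nonneg_nonneg intro: order_trans[OF zero_le_one])
    qed
    have "\<bar>x $ i - X * u $ i\<bar> \<le> 0" for i
      by (rule LIMSEQ_le_const[OF \<beta>0[of "K * X"]]) (use bound in auto)
    then have "x = X *\<^sub>R u" by (simp add: vec_eq_iff)
    then show "x \<in> {t *\<^sub>R u |t. 0 \<le> t}" using bound by auto
  next
    fix x
    assume "x \<in> {t *\<^sub>R u |t. 0 \<le> t}"
    then obtain t where t: "x = t *\<^sub>R u" "0 \<le> t" by auto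
    have "x \<in> (*v) (P n) ` nonneg_orthant" for n
    proof -
      \<comment> \<open>The preimage of \<open>u\<close> under \<open>P n\<close> is the limit of
        the preimages of normalised columns of \<open>P (n + k)\<close>. These are nonnegative
        because \<open>P (n + k)\<close> is \<open>P n\<close> times a nonnegative matrix. The
        column \<open>j\<close> is arbitrary.\<close>
      obtain R where R: "R ** P n = mat 1" "P n ** R = mat 1" using inv by (auto simp: invertible_def)
      define j :: 'd where "j = undefined"
      define y where "y k = (1 / c (n + k) j) *\<^sub>R column j (P (n + k))" for k
      have yi: "\<bar>y k $ i - u $ i\<bar> \<le> K * \<beta> ^ (n + k)" for k i
      proof -
        have "\<bar>y k $ i - u $ i\<bar> = \<bar>P (n + k) $ i $ j - c (n + k) j * u $ i\<bar> / c (n + k) j"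
          using c1[of "n + k" j] by (simp add: y_def column_def field_simps abs_divide)
        also have "\<dots> \<le> K * \<beta> ^ (n + k) / c (n + k) j"
          using close[of "n + k" i j] c1[of "n + k" j] by (intro divide_right_mono) (auto simp: c_def)
        also have "\<dots> \<le> K * \<beta> ^ (n + k) / 1"
          using c1[of "n + k" j] K \<beta> by (intro divide_left_mono) auto
        finally show ?thesis by simp
      qed
      have "(\<lambda>k. y k $ i) \<longlonglongrightarrow> u $ i" for i
      proof (rule LIM_zero_cancel, rule Lim_null_comparison)
        show "\<forall>\<^sub>F k in sequentially. norm (y k $ i - u $ i) \<le> (K * \<beta> ^ n) * \<beta> ^ k"
          using yi by (simp add: power_add mult.assoc)
      qed (rule \<beta>0)
      then have "y \<longlonglongrightarrow> u" by (rule vec_tendstoI)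
      then have lim: "(\<lambda>k. (R *v y k) $ i) \<longlonglongrightarrow> (R *v u) $ i" for i
        by (intro tendsto_vec_nth bounded_linear.tendsto[OF matrix_vector_mul_bounded_linear])
      have "0 \<le> (R *v y k) $ i" for k i
      proof -
        define B where "B = (of_int_mat (mprod M (int n) (int (n + k))) :: real ^ 'd ^ 'd)"
        have "P (n + k) = P n ** B"
          unfolding P_def Q_def B_def of_int_mat_mult[symmetric] by (subst mprod_split[of 0 "int n"]) auto
        then have "R ** P (n + k) = B" by (simp add: matrix_mul_assoc R)
        then have "R *v column j (P (n + k)) = column j B"
          by (metis matrix_vector_mult_basis matrix_vector_mul_assoc)
        then have "(R *v y k) $ i = B $ i $ j / c (n + k) j"
          by (simp add: y_def matrix_vector_mult_scaleR column_def)
        moreover have "0 \<le> B $ i $ j"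
          using mprod_nonneg_unimodular[of M "int n" "int (n + k)", OF M] by (simp add: B_def nonneg_unimodular_def)
        ultimately show ?thesis using c1[of "n + k" j] by simp
      qed
      then have "0 \<le> (R *v u) $ i" for i
        by (intro LIMSEQ_le_const[OF lim]) auto
      then have "t *\<^sub>R (R *v u) \<in> nonneg_orthant" using t by (simp add: nonneg_orthant_def)
      moreover have "P n *v (t *\<^sub>R (R *v u)) = x"
        using R t by (simp add: matrix_vector_mult_scaleR matrix_vector_mul_assoc)
      ultimately show ?thesis by (metis image_eqI)
    qed
    then show "x \<in> (\<Inter>n::nat. (*v) (of_int_mat (mprod M 0 (int n))) ` nonneg_orthant)"
      by (auto simp: P_def Q_def)
  qed
  have "rationally_independent u"
  proof (rule rationally_independent_if_integers)
    fix a :: "'d \<Rightarrow> int"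
    assume a: "(\<Sum>i\<in>UNIV. of_int (a i) * u $ i) = 0"
    define S where "S = (\<Sum>i\<in>UNIV. \<bar>real_of_int (a i)\<bar>)"
    \<comment> \<open>For this \<open>n\<close> the inner products of \<open>a\<close> with the
      columns of \<open>Q n\<close> have modulus below 1; being integers, they vanish, and
      invertibility of \<open>P n\<close> gives \<open>a = 0\<close>.\<close>
    obtain n where n: "S * K * \<beta> ^ n < 1"
      using order_tendstoD(2)[OF \<beta>0[of "S * K"], of 1] by (auto simp: eventually_sequentially)
    have "(\<Sum>i\<in>UNIV. a i * Q n $ i $ j) = 0" for j
    proof -
      have "(\<Sum>i\<in>UNIV. of_int (a i) * P n $ i $ j)
          = (\<Sum>i\<in>UNIV. of_int (a i) * (P n $ i $ j - c n j * u $ i)) + c n j * (\<Sum>i\<in>UNIV. of_int (a i) * u $ i)"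
        by (simp add: right_diff_distrib sum_subtractf sum_distrib_left mult_ac)
      also have "\<bar>\<dots>\<bar> \<le> (\<Sum>i\<in>UNIV. \<bar>real_of_int (a i)\<bar> * (K * \<beta> ^ n))"
        unfolding a using close
        by (simp add: c_def) (intro order_trans[OF sum_abs] sum_mono, auto simp: abs_mult intro!: mult_left_mono)
      also have "\<dots> = S * K * \<beta> ^ n" by (simp add: S_def sum_distrib_right mult.assoc)
      finally have "\<bar>of_int (\<Sum>i\<in>UNIV. a i * Q n $ i $ j)\<bar> < (1 :: real)"
        using n by (simp add: P_def)
      then show ?thesis by linarith
    qed
    then have "(\<chi> i. real_of_int (a i)) v* P n = 0"
      by (simp add: vector_matrix_mult_def vec_eq_iff P_def mult.commute flip: of_int_mult of_int_sum)
    moreover obtain R where "P n ** R = mat 1" using inv by (auto simp: invertible_def)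
    ultimately have "(\<chi> i. real_of_int (a i)) = 0"
      by (metis vector_matrix_mul_assoc vector_matrix_mul_rid vector_matrix_mult_0)
    then show "a = (\<lambda>_. 0)" by (auto simp: vec_eq_iff)
  qed
  moreover have "converges_exponentially M u"
    unfolding converges_exponentially_def
  proof (intro exI conjI allI)
    show "0 < K * real CARD('d)" using K by simp
    show "0 < - ln \<beta>" using \<beta> by simp
    fix n :: nat and j
    have "infdist (P n *v axis j 1) (span {u}) \<le> dist (P n *v axis j 1) (c n j *\<^sub>R u)"
      by (intro infdist_le span_scale span_base) simp
    also have "\<dots> \<le> (\<Sum>i\<in>UNIV. \<bar>(P n *v axis j 1 - c n j *\<^sub>R u) $ i\<bar>)"
      unfolding dist_norm by (rule norm_le_l1_cart)
    also have "\<dots> \<le> (\<Sum>i\<in>(UNIV :: 'd set). K * \<beta> ^ n)"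
      using close by (intro sum_mono) (simp add: matrix_vector_mult_basis column_def c_def)
    also have "\<beta> ^ n = exp (- (- ln \<beta>) * real n)"
      using \<beta> by (simp add: exp_of_nat2_mult)
    finally show "infdist (of_int_mat (mprod M 0 (int n)) *v axis j 1) (span {u})
        \<le> K * real CARD('d) * exp (- (- ln \<beta>) * real n)"
      by (simp add: P_def Q_def mult_ac)
  qed
  ultimately show ?thesis using that ge by blast
qed

section \<open>Irreducibility of the characteristic polynomial\<close>

lemma map_poly_of_int_mult:
  "map_poly of_int (p * q) = map_poly of_int p * (map_poly of_int q :: 'a::comm_ring_1 poly)"
  by (rule poly_eqI) (simp add: coeff_map_poly coeff_mult)

lemma map_poly_of_int_add:
  "map_poly of_int (p + q) = map_poly of_int p + (map_poly of_int q :: 'a::comm_ring_1 poly)"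
  by (rule poly_eqI) (simp add: coeff_map_poly)

lemma map_poly_of_int_diff:
  "map_poly of_int (p - q) = map_poly of_int p - (map_poly of_int q :: 'a::comm_ring_1 poly)"
  by (rule poly_eqI) (simp add: coeff_map_poly)

lemma charpoly_of_int_mat:
  "charpoly (of_int_mat A) = (map_poly of_int (charpoly A) :: 'a::comm_ring_1 poly)"
proof -
  have "map_poly of_int (charpoly A)
      = (det (map_matrix (map_poly of_int) (mat [:0, 1:] - map_matrix (\<lambda>a. [:a:]) A)) :: 'a poly)"
    unfolding charpoly_def
    by (rule det_map_matrix[symmetric])
       (auto simp: map_poly_of_int_mult map_poly_of_int_add map_poly_of_int_diff[of 0, simplified])
  also have "map_matrix (map_poly of_int) (mat [:0, 1:] - map_matrix (\<lambda>a. [:a:]) A)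
      = (mat [:0, 1:] - map_matrix (\<lambda>a. [:a:]) (of_int_mat A) :: 'a poly ^ 'b ^ 'b)"
    by (simp add: vec_eq_iff mat_def map_poly_of_int_diff map_poly_pCons)
  finally show ?thesis by (simp add: charpoly_def)
qed

text \<open>In the Leibniz expansion the identity permutation contributes a product of monic linear
  factors; any other permutation picks an off-diagonal constant and has smaller degree.\<close>

lemma charpoly_monic:
  fixes A :: "'a::idom ^ 'n ^ 'n"
  shows "degree (charpoly A) = CARD('n)" "lead_coeff (charpoly A) = 1"
proof -
  define B where "B = mat [:0, 1:] - map_matrix (\<lambda>a. [:a:]) A"
  define t where "t p = of_int (sign p) * (\<Prod>i\<in>UNIV. B $ i $ p i)" for p :: "'n \<Rightarrow> 'n"
  have B: "B $ i $ j = (if i = j then [:- A $ i $ i, 1:] else [:- A $ i $ j:])" for i j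
    by (simp add: B_def mat_def)
  have id: "t id = (\<Prod>i\<in>UNIV. [:- A $ i $ i, 1:])"
    by (simp add: t_def B)
  have did: "degree (t id) = CARD('n)"
    unfolding id by (subst degree_prod_eq_sum_degree) auto
  have lid: "lead_coeff (t id) = 1"
    unfolding id by (subst lead_coeff_prod) simp
  have small: "degree (t p) < CARD('n)" if "p \<noteq> id" for p
  proof -
    have "\<exists>k. p k \<noteq> k" using that by (auto simp: fun_eq_iff)
    then obtain k where k: "p k \<noteq> k" by blast
    have "degree (t p) \<le> degree (\<Prod>i\<in>UNIV. B $ i $ p i)"
      by (simp add: t_def sign_def)
    also have "\<dots> \<le> (\<Sum>i\<in>UNIV. degree (B $ i $ p i))"
      using degree_prod_sum_le[of UNIV "\<lambda>i. B $ i $ p i"] by (simp add: o_def)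
    also have "\<dots> < (\<Sum>i\<in>(UNIV :: 'n set). 1)"
      using k by (intro sum_strict_mono_ex1) (auto simp: B intro!: exI[of _ k])
    finally show ?thesis by simp
  qed
  define r where "r = (\<Sum>p\<in>{p. p permutes (UNIV :: 'n set)} - {id}. t p)"
  have c: "charpoly A = t id + r"
    unfolding charpoly_def det_def B_def[symmetric] r_def
    by (subst sum.remove[of _ id]) (auto simp: t_def finite_permutations permutes_id)
  have "degree r < CARD('n)"
    unfolding r_def by (rule degree_sum_less) (auto intro: small)
  then have "degree r < degree (t id)" by (simp add: did)
  then show "degree (charpoly A) = CARD('n)" "lead_coeff (charpoly A) = 1"
    unfolding c using did lid by (auto simp: degree_add_eq_left coeff_eq_0)
qed

lemma clear_denominators:
  fixes f :: "rat poly"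
  obtains a F where "a \<noteq> 0" "map_poly of_int F = smult (of_int a) f"
proof -
  have "\<exists>a F. a \<noteq> 0 \<and> map_poly of_int F = smult (of_int a) f"
  proof (induction f)
    case 0
    show ?case by (intro exI[of _ 1] exI[of _ 0]) simp
  next
    case (pCons c f)
    then obtain a F where F: "a \<noteq> 0" "map_poly of_int F = smult (of_int a) f" by blast
    obtain x y where xy: "quotient_of c = (x, y)" by force
    then have "c = of_int x / of_int y" "y > 0" by (auto simp: quotient_of_div quotient_of_denom_pos)
    then show ?case using F
      by (intro exI[of _ "a * y"] exI[of _ "pCons (x * a) (smult y F)"])
         (auto simp: map_poly_pCons map_poly_smult mult_ac)
  qed
  then show ?thesis using that by blast
qed

lemma primitive_int_multiple:
  fixes f :: "rat poly"
  assumes "f \<noteq> 0"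
  obtains c F where "c \<noteq> 0" "map_poly of_int F = smult c f" "content F = 1"
proof -
  obtain a F where F: "a \<noteq> 0" "map_poly of_int F = smult (of_int a) f"
    by (rule clear_denominators)
  have "F \<noteq> 0" using F assms by auto
  have "map_poly of_int F = smult (of_int (content F)) (map_poly of_int (primitive_part F) :: rat poly)"
    by (subst content_times_primitive_part[symmetric]) (simp only: map_poly_smult of_int_0 of_int_mult)
  then have "map_poly of_int (primitive_part F) = smult (of_int a / of_int (content F)) f"
    using F \<open>F \<noteq> 0\<close> by (metis content_eq_zero_iff divide_inverse_commute of_int_eq_0_iff smult_smult left_inverse smult_1_left)
  moreover have "content (primitive_part F) = 1" using \<open>F \<noteq> 0\<close> by simp
  ultimately show ?thesis using that F \<open>F \<noteq> 0\<close> by (metis content_eq_zero_iff divide_eq_0_iff of_int_eq_0_iff)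
qed

text \<open>Gauss's lemma: primitive multiples \<open>F\<close>, \<open>G\<close> of the factors
  satisfy \<open>smult y (F * G) = smult x p\<close> with integers \<open>x\<close>,
  \<open>y\<close>. Since \<open>F * G\<close> and \<open>p\<close> have content 1, these differ at
  most in sign, which \<open>F\<close> absorbs.\<close>

lemma monic_int_poly_factor:
  fixes p :: "int poly" and f g :: "rat poly"
  assumes p: "lead_coeff p = 1" and fg: "map_poly of_int p = f * g"
  obtains F G where "p = F * G" "degree F = degree f" "degree G = degree g"
proof -
  have "map_poly of_int p \<noteq> (0 :: rat poly)" using p by (metis coeff_0 coeff_map_poly of_int_0 of_int_1 zero_neq_one)
  then have nz: "f \<noteq> 0" "g \<noteq> 0" using fg by auto
  obtain a F where F: "a \<noteq> 0" "map_poly of_int F = smult a f" "content F = 1"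
    using primitive_int_multiple[OF nz(1)] .
  obtain b G where G: "b \<noteq> 0" "map_poly of_int G = smult b g" "content G = 1"
    using primitive_int_multiple[OF nz(2)] .
  obtain x y where xy: "quotient_of (a * b) = (x, y)" by force
  then have ab: "a * b = of_int x / of_int y" "y > 0" by (auto simp: quotient_of_div quotient_of_denom_pos)
  have "map_poly rat_of_int (smult y (F * G)) = smult (of_int y * (a * b)) (f * g)"
    by (simp add: map_poly_smult map_poly_of_int_mult F G mult_ac)
  also have "\<dots> = map_poly of_int (smult x p)"
    using ab by (simp add: map_poly_smult fg)
  finally have e: "map_poly rat_of_int (smult y (F * G)) = map_poly of_int (smult x p)" .
  have eq: "smult y (F * G) = smult x p"
  proof (rule poly_eqI)
    fix n
    show "coeff (smult y (F * G)) n = coeff (smult x p) n"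
      using arg_cong[OF e, of "\<lambda>q. coeff q n"] by (simp only: coeff_map_poly of_int_0 of_int_eq_iff)
  qed
  have "content p dvd 1" using p content_dvd_coeff by metis
  then have "content p = 1" using is_unit_content_iff by blast
  then have "\<bar>y\<bar> = \<bar>x\<bar>"
    using arg_cong[OF eq, of content] F(3) G(3) by (simp add: content_mult)
  then have "x = y \<or> x = - y" by linarith
  then have "smult y (F * G - p) = 0 \<or> smult y (F * G + p) = 0"
    using eq by (auto simp: smult_diff_right smult_add_right)
  then have "p = F * G \<or> p = - F * G"
    using ab(2) by (auto simp: eq_neg_iff_add_eq_0 add.commute)
  moreover have "degree F = degree f"
    using arg_cong[OF F(2), of degree] F(1) by (simp add: degree_map_poly)
  moreover have "degree G = degree g"
    using arg_cong[OF G(2), of degree] G(1) by (simp add: degree_map_poly)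
  ultimately show ?thesis using that[of F G] that[of "- F" G] by auto
qed

text \<open>As the leading coefficient has modulus 1, the product of the moduli of all complex roots
  is the modulus of the constant coefficient, a nonzero integer and hence at least 1.\<close>

lemma int_poly_root_norm_ge_1:
  fixes G :: "int poly"
  assumes "\<bar>lead_coeff G\<bar> = 1" "degree G > 0" "poly G 0 \<noteq> 0"
  obtains x :: complex where "poly (map_poly of_int G) x = 0" "1 \<le> norm x"
proof -
  define H where "H = (map_poly of_int G :: complex poly)"
  have deg: "degree H = degree G" by (simp add: H_def degree_map_poly)
  then have "H \<noteq> 0" using assms(2) by auto
  have lc: "norm (lead_coeff H) = 1"
    unfolding deg using assms(1) by (simp add: H_def coeff_map_poly)
  have "poly H 0 = poly (smult (lead_coeff H) (\<Prod>x\<in>#proots H. [:-x, 1:])) 0"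
    by (simp only: complex_poly_decompose_multiset)
  moreover have "norm (poly (\<Prod>x\<in>#X. [:-x, 1:]) 0) = (\<Prod>x\<in>#X. norm x)" for X :: "complex multiset"
    by (induction X) (auto simp: norm_mult)
  ultimately have prod: "norm (poly H 0) = (\<Prod>x\<in>#proots H. norm x)"
    using lc by (simp only: poly_smult norm_mult mult_1)
  have "poly H 0 = of_int (poly G 0)" by (simp add: H_def poly_0_coeff_0 coeff_map_poly)
  then have ge: "1 \<le> norm (poly H 0)" using assms(3) by simp
  have lt: "(\<Prod>x\<in>#X. norm x) < 1" if "X \<noteq> {#}" "\<forall>x\<in>#X. norm x < 1" for X :: "complex multiset"
    using that
  proof (induction X)
    case (add x X)
    show ?case
    proof (cases "X = {#}")
      case False
      then have "(\<Prod>x\<in>#X. norm x) < 1" using add by simp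
      moreover have "0 \<le> (\<Prod>x\<in>#X. norm x)" by (induction X) auto
      ultimately show ?thesis using add.prems(2)
        by simp (metis mult_strict_mono' norm_ge_zero mult_1)
    qed (use add in simp)
  qed simp
  have "proots H \<noteq> {#}" using size_proots_complex[of H] deg assms(2) by auto
  then obtain x where "x \<in># proots H" "1 \<le> norm x"
    using lt[of "proots H"] ge prod by fastforce
  then show ?thesis using that \<open>H \<noteq> 0\<close> by (simp add: H_def)
qed

text \<open>
  Every nonconstant integer factor with constant coefficient \<open>\<noteq> 0\<close> has a root outside the open
  unit disc, so two factors would need two such roots.
\<close>

lemma irreducible_if_one_large_root:
  fixes p :: "int poly" and h :: "complex poly"
  assumes p: "lead_coeff p = 1" "degree p > 0" "poly p 0 \<noteq> 0"
    and h: "map_poly of_int p = [:- \<rho>, 1:] * h" "\<And>x. poly h x = 0 \<Longrightarrow> norm x < 1"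
  shows "irreducible (map_poly of_int p :: rat poly)"
proof (rule irreducibleI)
  have deg: "degree (map_poly of_int p :: rat poly) = degree p" by (simp add: degree_map_poly)
  then show "map_poly of_int p \<noteq> (0 :: rat poly)" using p(2) by auto
  then show "\<not> map_poly of_int p dvd (1 :: rat poly)" using p(2) deg by (subst is_unit_iff_degree) auto
  fix f g :: "rat poly"
  assume fg: "map_poly of_int p = f * g"
  then have nz: "f \<noteq> 0" "g \<noteq> 0" using \<open>map_poly of_int p \<noteq> (0 :: rat poly)\<close> by auto
  obtain F G where FG: "p = F * G" "degree F = degree f" "degree G = degree g"
    using monic_int_poly_factor[OF p(1) fg] .
  \<comment> \<open>Once the linear factor of \<open>\<rho>\<close> contained in \<open>F'\<close>
    is cancelled, all of \<open>G'\<close> divides \<open>h\<close>, even if \<open>\<rho>\<close>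
    is a repeated root. So every root of \<open>G'\<close> lies in the open unit disc.\<close>
  have key: "degree G' = 0" if FG': "p = F' * G'" and F'\<rho>: "poly (map_poly of_int F') \<rho> = 0" for F' G'
  proof (rule ccontr)
    assume d: "degree G' \<noteq> 0"
    have "lead_coeff F' * lead_coeff G' = 1" using p(1) FG' by (simp add: lead_coeff_mult)
    then have "\<bar>lead_coeff G'\<bar> = 1" by (metis abs_zmult_eq_1 mult.commute abs_1)
    moreover have "poly G' 0 \<noteq> 0" using p(3) FG' by auto
    ultimately obtain x where x: "poly (map_poly of_int G') x = (0 :: complex)" "1 \<le> norm x"
      using int_poly_root_norm_ge_1 d by blast
    obtain F1 where F1: "map_poly of_int F' = [:- \<rho>, 1:] * F1"
      using F'\<rho> by (auto simp: poly_eq_0_iff_dvd elim: dvdE)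
    have "[:- \<rho>, 1:] * (F1 * map_poly of_int G') = [:- \<rho>, 1:] * h"
      using h(1) unfolding FG' map_poly_of_int_mult F1 by (simp only: mult.assoc)
    then have "F1 * map_poly of_int G' = h" by (metis mult_left_cancel pCons_eq_0_iff zero_neq_one)
    then have "poly h x = 0" using x by auto
    then show False using h(2) x(2) by force
  qed
  have "poly (map_poly of_int F * map_poly of_int G) \<rho> = 0"
    unfolding map_poly_of_int_mult[symmetric] FG(1)[symmetric] h(1) by simp
  then have "degree G = 0 \<or> degree F = 0"
    using key[of F G] key[of G F] FG(1) by (auto simp: mult.commute)
  then show "f dvd 1 \<or> g dvd 1" using FG nz by (auto simp: is_unit_iff_degree)
qed

text \<open>Perron--Frobenius, from Brouwer's theorem on the standard simplex.\<close>

lemma positive_matrix_eigenvector: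
  fixes P :: "real ^ 'n ^ 'n"
  assumes pos: "\<And>i j. 0 < P $ i $ j"
  obtains \<rho> z where "\<And>i. 0 < z $ i" "P *v z = \<rho> *\<^sub>R z" "\<And>j. P $ j $ j \<le> \<rho>"
proof -
  define S where "S = {x :: real ^ 'n. (\<forall>i. 0 \<le> x $ i) \<and> (\<Sum>i\<in>UNIV. x $ i) = 1}"
  define \<phi> where "\<phi> x = (\<Sum>i\<in>UNIV. (P *v x) $ i)" for x
  have Px: "0 < (P *v x) $ i" if x: "x \<in> S" for x i
  proof -
    have "\<exists>j. x $ j \<noteq> 0" using x by (auto simp: S_def) (metis sum.neutral zero_neq_one)
    then obtain j where "0 < x $ j" using x by (auto simp: S_def order_less_le)
    then show ?thesis
      unfolding matrix_vector_mult_def using x pos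
      by (auto simp: S_def less_imp_le intro!: sum_pos2[of _ j])
  qed
  have \<phi>: "0 < \<phi> x" if "x \<in> S" for x
    unfolding \<phi>_def using Px[OF that] by (intro sum_pos) auto
  have "compact S"
    unfolding compact_eq_bounded_closed
  proof
    have "norm x \<le> 1" if "x \<in> S" for x
      using norm_le_l1_cart[of x] that by (auto simp: S_def)
    then show "bounded S" by (auto simp: bounded_iff)
    show "closed S"
      unfolding S_def
      by (intro closed_Collect_conj closed_Collect_all closed_Collect_le closed_Collect_eq continuous_intros)
  qed
  moreover have "convex S"
    by (auto simp: S_def convex_def sum.distrib sum_distrib_left[symmetric])
  moreover have "axis undefined 1 \<in> S"
    by (simp add: S_def axis_def)
  then have "S \<noteq> {}" by auto
  moreover have "continuous_on S (\<lambda>x. (1 / \<phi> x) *\<^sub>R (P *v x))"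
    using \<phi> unfolding \<phi>_def
    by (intro continuous_intros matrix_vector_mult_linear_continuous_on) (force simp: less_le)
  moreover have "(1 / \<phi> x) *\<^sub>R (P *v x) \<in> S" if "x \<in> S" for x
    using \<phi>[OF that] Px[OF that]
    by (auto simp: S_def less_imp_le sum_divide_distrib[symmetric] \<phi>_def[symmetric])
  ultimately obtain z where z: "z \<in> S" "(1 / \<phi> z) *\<^sub>R (P *v z) = z"
    using brouwer[of S "\<lambda>x. (1 / \<phi> x) *\<^sub>R (P *v x)"] by blast
  have eig: "P *v z = \<phi> z *\<^sub>R z"
    using \<phi>[OF z(1)] arg_cong[OF z(2), of "\<lambda>x. \<phi> z *\<^sub>R x"] by simp
  have zpos: "0 < z $ i" for i
    using Px[OF z(1), of i] \<phi>[OF z(1)] by (simp add: eig zero_less_mult_iff)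
  \<comment> \<open>A single term of the positive sum \<open>(P *v z) $ j\<close>; this is the link
    between the eigenvalue and the size of the matrix.\<close>
  have "P $ j $ j \<le> \<phi> z" for j
  proof -
    have "P $ j $ j * z $ j \<le> (P *v z) $ j"
      unfolding matrix_vector_mult_def using zpos pos
      by (auto intro!: member_le_sum[of j UNIV "\<lambda>k. P $ j $ k * z $ k"] simp: less_imp_le)
    then show ?thesis using zpos[of j] by (simp add: eig)
  qed
  then show ?thesis using that zpos eig by blast
qed

text \<open>
  Replacing column \<open>k\<close> of \<open>x I - A\<close> by \<open>z\<close> divides the characteristic polynomial by
  \<open>x - \<rho>\<close>, by Cramer's rule.
\<close>

lemma second_eigenvector:
  fixes A :: "complex ^ 'n ^ 'n"
  assumes z: "A *v z = \<rho> *s z" "z $ k \<noteq> 0"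
    and h: "charpoly A = [:- \<rho>, 1:] * h" "poly h \<mu> = 0"
  obtains y t where "y \<noteq> 0" "y $ k = 0" "A *v y = \<mu> *s y + t *s z"
proof -
  define W where "W x = (\<chi> i j. if j = k then z $ i else (mat x - A) $ i $ j)" for x
  define D where "D = det (\<chi> i j. if j = k then [:z $ i:] else (mat [:0, 1:] - map_matrix (\<lambda>a. [:a:]) A) $ i $ j)"
  have D: "poly D x = det (W x)" for x
  proof -
    have "poly D x = det (map_matrix (\<lambda>p. poly p x)
        (\<chi> i j. if j = k then [:z $ i:] else (mat [:0, 1:] - map_matrix (\<lambda>a. [:a:]) A) $ i $ j))"
      unfolding D_def by (rule det_map_matrix[symmetric]) auto
    also have "\<dots> = det (W x)"
      by (intro arg_cong[of _ _ det]) (simp add: W_def vec_eq_iff mat_def)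
    finally show ?thesis .
  qed
  \<comment> \<open>Cramer's rule needs \<open>x \<noteq> \<rho>\<close>, where \<open>z\<close> is
    the image of \<open>w\<close>. Keeping the factor for \<open>\<rho>\<close> on both sides makes
    the remaining point trivial; it is cancelled only between polynomials.\<close>
  have "poly ([:- \<rho>, 1:] * D) x = poly ([:- \<rho>, 1:] * smult (z $ k) h) x" for x
  proof (cases "x = \<rho>")
    case False
    define w where "w = (1 / (x - \<rho>)) *s z"
    have "(mat x - A) *v z = (x - \<rho>) *s z"
      using z(1) by (simp add: matrix_vector_mult_diff_rdistrib vec_eq_iff)
        (simp add: matrix_vector_mult_def mat_def if_distrib[of "\<lambda>t. t * _"] left_diff_distrib cong: if_cong)
    then have "(mat x - A) *v w = (1 / (x - \<rho>)) *s ((x - \<rho>) *s z)"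
      by (simp only: w_def vector_scalar_commute)
    also have "\<dots> = z" using False by (simp only: vector_smult_assoc) simp
    finally have Aw: "(mat x - A) *v w = z" .
    have "W x = (\<chi> i j. if j = k then ((mat x - A) *v w) $ i else (mat x - A) $ i $ j)"
      unfolding Aw W_def ..
    then have "det (W x) = w $ k * det (mat x - A)"
      by (simp only: cramer_lemma)
    also have "\<dots> = z $ k / (x - \<rho>) * poly ([:- \<rho>, 1:] * h) x"
      by (simp add: w_def poly_charpoly[symmetric] h(1))
    finally show ?thesis using False by (simp add: D field_simps)
  qed simp
  then have "[:- \<rho>, 1:] * D = [:- \<rho>, 1:] * smult (z $ k) h"
    by (metis poly_eq_poly_eq_iff ext)
  then have "D = smult (z $ k) h" by (metis mult_left_cancel pCons_eq_0_iff zero_neq_one)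
  then have "det (W \<mu>) = 0" using h(2) D[of \<mu>] by simp
  then have "\<not> invertible (W \<mu>)" by (simp add: invertible_det_nz)
  \<comment> \<open>The kernel vector \<open>w\<close> splits into its coordinate \<open>k\<close>,
    which multiplies \<open>z\<close>, and the rest \<open>y\<close>. This covers a repeated root or
    a missing eigenvector as well, where \<open>A *v y\<close> may keep a component along
    \<open>z\<close>.\<close>
  then obtain w where w: "W \<mu> *v w = 0" "w \<noteq> 0"
    by (auto simp: invertible_left_inverse matrix_left_invertible_ker)
  define y where "y = (\<chi> j. if j = k then 0 else w $ j)"
  have Ay: "A *v y = \<mu> *s y + w $ k *s z"
  proof (subst vec_eq_iff, intro allI)
    fix i
    have "0 = (\<Sum>j\<in>UNIV. W \<mu> $ i $ j * w $ j)"
      using w(1) by (simp add: matrix_vector_mult_def vec_eq_iff)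
    also have "\<dots> = (\<Sum>j\<in>UNIV. (if j = k then z $ i * w $ k else 0) + (mat \<mu> - A) $ i $ j * y $ j)"
      by (intro sum.cong) (auto simp: W_def y_def)
    also have "\<dots> = z $ i * w $ k + (\<Sum>j\<in>UNIV. mat \<mu> $ i $ j * y $ j) - (A *v y) $ i"
      by (simp add: sum.distrib matrix_vector_mult_def sum_subtractf left_diff_distrib)
    also have "(\<Sum>j\<in>UNIV. mat \<mu> $ i $ j * y $ j) = \<mu> * y $ i"
      by (simp add: mat_def if_distrib[of "\<lambda>t. t * _"] cong: if_cong)
    finally show "(A *v y) $ i = (\<mu> *s y + w $ k *s z) $ i" by (simp add: algebra_simps)
  qed
  have "y \<noteq> 0"
  proof
    assume "y = 0"
    then have "w $ k * z $ k = 0" using arg_cong[OF Ay, of "\<lambda>v. v $ k"] by simp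
    then have "w $ k = 0" using z(2) by simp
    then have "w = 0" using \<open>y = 0\<close> by (auto simp: y_def vec_eq_iff split: if_splits)
    then show False using w(2) by simp
  qed
  then show ?thesis using that[OF _ _ Ay] by (simp add: y_def)
qed

text \<open>The bivector of \<open>z\<close> and \<open>y\<close> is an eigenvector of the second
  exterior power of \<open>A\<close> with eigenvalue \<open>\<rho> * \<mu>\<close>, since the term
  \<open>t *s z\<close> drops out against \<open>z\<close>. The bound is read off at a coordinate of
  largest modulus.\<close>

lemma two_eigenvalues_le_minors:
  fixes A :: "complex ^ 'n ^ 'n"
  assumes Az: "A *v z = \<rho> *s z" "z $ k \<noteq> 0"
    and Ay: "A *v y = \<mu> *s y + t *s z" "y \<noteq> 0" "y $ k = 0"
    and m: "\<And>i j k l. norm (minor A i j k l) \<le> m"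
  shows "norm (\<rho> * \<mu>) \<le> (real CARD('n))\<^sup>2 * m"
proof -
  define D where "D i j = z $ i * y $ j - z $ j * y $ i" for i j
  define X where "X = (\<lambda>(i, j). norm (D i j)) ` UNIV"
  define b where "b = Max X"
  have "b \<in> X" unfolding b_def X_def by (intro Max_in) auto
  then obtain i j where ij: "b = norm (D i j)" by (auto simp: X_def)
  have max: "norm (D k l) \<le> norm (D i j)" for k l
    unfolding ij[symmetric] b_def by (intro Max_ge) (auto simp: X_def)
  obtain l where "y $ l \<noteq> 0" using Ay(2) by (auto simp: vec_eq_iff)
  \<comment> \<open>As \<open>y $ k = 0\<close>, the coordinate \<open>D k l\<close> is just
    \<open>z $ k * y $ l\<close>, so the bivector is nonzero.\<close>
  then have "D k l \<noteq> 0" using Az(2) Ay(3) by (simp add: D_def)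
  then have Dpos: "norm (D i j) > 0" using max[of k l] by (meson less_le_trans zero_less_norm_iff)
  have "\<rho> * \<mu> * D i j = (A *v z) $ i * (A *v y) $ j - (A *v z) $ j * (A *v y) $ i"
    unfolding Az Ay by (simp add: D_def algebra_simps)
  also have "\<dots> = (\<Sum>k\<in>UNIV. \<Sum>l\<in>UNIV. minor A i j k l * (z $ k * y $ l))"
    by (simp add: matrix_vector_mult_def sum_product minor_def sum_subtractf left_diff_distrib)
       (simp add: mult_ac)
  finally have 1: "\<rho> * \<mu> * D i j = (\<Sum>k\<in>UNIV. \<Sum>l\<in>UNIV. minor A i j k l * (z $ k * y $ l))" .
  \<comment> \<open>Swapping the summation indices changes the sign of the minor; adding both forms
    turns \<open>z $ k * y $ l\<close> into the antisymmetric \<open>D k l\<close>, which the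
    maximum controls.\<close>
  also have "\<dots> = (\<Sum>k\<in>UNIV. \<Sum>l\<in>UNIV. minor A i j l k * (z $ l * y $ k))"
    by (rule sum.swap)
  also have "\<dots> = - (\<Sum>k\<in>UNIV. \<Sum>l\<in>UNIV. minor A i j k l * (z $ l * y $ k))"
    unfolding sum_negf[symmetric] by (intro sum.cong refl) (simp add: minor_def algebra_simps)
  finally have "2 * (\<rho> * \<mu> * D i j) = (\<Sum>k\<in>UNIV. \<Sum>l\<in>UNIV. minor A i j k l * D k l)"
    using 1 by (simp add: D_def right_diff_distrib sum_subtractf)
  also have "norm \<dots> \<le> (\<Sum>k\<in>(UNIV :: 'n set). \<Sum>l\<in>(UNIV :: 'n set). m * norm (D i j))"
    by (intro order_trans[OF norm_sum] sum_mono)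
       (auto simp: norm_mult intro!: mult_mono m max intro: order_trans[OF norm_ge_zero m])
  also have "\<dots> = (real CARD('n))\<^sup>2 * m * norm (D i j)"
    by (simp add: power2_eq_square)
  finally have "2 * norm (\<rho> * \<mu>) * norm (D i j) \<le> (real CARD('n))\<^sup>2 * m * norm (D i j)"
    by (simp add: norm_mult)
  then have "2 * norm (\<rho> * \<mu>) \<le> (real CARD('n))\<^sup>2 * m" using Dpos by simp
  then show ?thesis using norm_ge_zero[of "\<rho> * \<mu>"] by linarith
qed

text \<open>For a root \<open>\<mu>\<close> of the cofactor \<open>h\<close>, the modulus of
  \<open>\<rho> * \<mu>\<close> is at most \<open>(real CARD('n))\<^sup>2 * m\<close>, hence below a
  diagonal entry, which in turn is at most \<open>\<rho>\<close>. Thus \<open>\<mu>\<close> lies in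
  the open unit disc.\<close>

lemma irreducible_charpoly:
  fixes Q :: "int ^ 'n ^ 'n"
  assumes pos: "positive_mat Q" and det: "det Q \<noteq> 0"
    and m: "\<And>i j k l. \<bar>minor (of_int_mat Q :: real ^ 'n ^ 'n) i j k l\<bar> \<le> m"
    and large: "(real CARD('n))\<^sup>2 * m < of_int (Q $ r $ r)"
  shows "irreducible (charpoly (of_int_mat Q :: rat ^ 'n ^ 'n))"
proof -
  define P where "P = (of_int_mat Q :: real ^ 'n ^ 'n)"
  define A where "A = (of_int_mat Q :: complex ^ 'n ^ 'n)"
  have "0 < P $ i $ j" for i j using pos by (simp add: P_def positive_mat_def)
  from positive_matrix_eigenvector[OF this]
  obtain \<rho> z where z: "\<And>i. 0 < z $ i" "P *v z = \<rho> *\<^sub>R z" "\<And>j. P $ j $ j \<le> \<rho>"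
    by metis
  define zc :: "complex ^ 'n" where "zc = (\<chi> i. of_real (z $ i))"
  have "of_real ((P *v z) $ i) = (of_real (\<rho> * z $ i) :: complex)" for i by (simp add: z(2))
  then have Az: "A *v zc = of_real \<rho> *s zc"
    by (simp add: vec_eq_iff A_def P_def zc_def matrix_vector_mult_def)
  have zk: "zc $ r \<noteq> 0" using z(1)[of r] by (simp add: zc_def)
  have "(mat (of_real \<rho>) - A) *v zc = 0"
    using Az by (simp add: matrix_vector_mult_diff_rdistrib vec_eq_iff)
      (simp add: matrix_vector_mult_def mat_def if_distrib[of "\<lambda>t. t * _"] left_diff_distrib cong: if_cong)
  moreover have "zc \<noteq> 0" using zk by auto
  ultimately have "\<not> invertible (mat (of_real \<rho>) - A)"
    by (auto simp: invertible_left_inverse matrix_left_invertible_ker)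
  then have "poly (charpoly A) (of_real \<rho>) = 0"
    by (simp add: poly_charpoly invertible_det_nz)
  then obtain h where h: "charpoly A = [:- of_real \<rho>, 1:] * h"
    by (auto simp: poly_eq_0_iff_dvd elim: dvdE)
  have "norm \<mu> < 1" if h\<mu>: "poly h \<mu> = 0" for \<mu>
  proof -
    obtain y t where y: "y \<noteq> 0" "y $ r = 0" "A *v y = \<mu> *s y + t *s zc"
      using second_eigenvector[OF Az zk h h\<mu>] .
    have "norm (minor A i j k l) \<le> m" for i j k l
    proof -
      have "minor A i j k l = of_real (minor P i j k l)"
        by (simp add: minor_def A_def P_def)
      then show ?thesis using m by (simp add: P_def)
    qed
    then have "norm (of_real \<rho> * \<mu>) \<le> (real CARD('n))\<^sup>2 * m"
      by (rule two_eigenvalues_le_minors[OF Az zk y(3,1,2)])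
    also have "\<dots> < \<rho>" using large z(3)[of r] by (simp add: P_def)
    finally show ?thesis using z(3)[of r] pos
      by (simp add: norm_mult P_def positive_mat_def) (smt (verit) mult_le_cancel_left1 of_int_0_less_iff)
  qed
  moreover have "poly (charpoly Q) 0 \<noteq> 0"
  proof -
    \<comment> \<open>The constant coefficient is the determinant of \<open>- Q\<close>; the scalar
      factor has nonzero determinant because its square is the identity.\<close>
    have "- Q = mat (- 1) ** Q"
      by (simp add: vec_eq_iff matrix_matrix_mult_def mat_def if_distrib[of "\<lambda>t. t * _"] cong: if_cong)
    moreover have "mat (- 1) ** mat (- 1) = (mat 1 :: int ^ 'n ^ 'n)"
      by (simp add: vec_eq_iff matrix_matrix_mult_def mat_def if_distrib[of "\<lambda>t. t * _"] cong: if_cong)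
    then have "det (mat (- 1) :: int ^ 'n ^ 'n) \<noteq> 0"
      by (metis det_I det_mul mult_zero_left zero_neq_one)
    ultimately show ?thesis using det by (simp add: poly_charpoly det_mul)
  qed
  moreover have "degree (charpoly Q) > 0" by (simp add: charpoly_monic(1))
  moreover have "map_poly of_int (charpoly Q) = [:- of_real \<rho>, 1:] * h"
    using h unfolding A_def charpoly_of_int_mat .
  ultimately show ?thesis
    unfolding charpoly_of_int_mat by (intro irreducible_if_one_large_root[OF charpoly_monic(2)])
qed

text \<open>Two comparisons are needed: minors are controlled for products starting at 0, while the
  claim concerns those starting at \<open>m\<close>; and the criterion asks for a large diagonal
  entry, which a fixed positive initial block makes comparable to the entry sum.\<close>

lemma mprod_alg_irreducible:
  fixes M :: "int \<Rightarrow> int ^ 'd ^ 'd"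
  assumes M: "\<And>n. M n \<in> nonneg_unimodular" and prim: "primitive M" and \<beta>: "0 < \<beta>" "\<beta> < 1"
    and minors: "\<And>n i j k l. \<bar>minor (of_int_mat (mprod M 0 (int n))) i j k l\<bar> * entry_sum (of_int_mat (M (int n)))
        \<le> C * \<beta> ^ n * entry_sum (of_int_mat (mprod M 0 (int n)))"
  shows "alg_irreducible M"
  unfolding alg_irreducible_def
proof
  fix m :: int
  define R where "R n = (of_int_mat (mprod M 0 (int n)) :: real ^ 'd ^ 'd)" for n
  define P where "P n = (of_int_mat (mprod M m (int n)) :: real ^ 'd ^ 'd)" for n
  define d where "d = real CARD('d)"
  have d: "d > 0" by (simp add: d_def)
  have Q: "mprod M m n \<in> nonneg_unimodular" for m n
    by (rule mprod_nonneg_unimodular[OF M])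
  have inv: "\<exists>Y. Y ** of_int_mat (mprod M m n) = (mat 1 :: real ^ 'd ^ 'd)" for m n
  proof -
    have "invertible (of_int_mat (mprod M m n) :: real ^ 'd ^ 'd)"
      using Q[of m n] by (auto simp: invertible_det_nz det_of_int_mat nonneg_unimodular_def)
    then show ?thesis by (auto simp: invertible_def)
  qed
  \<comment> \<open>One of \<open>X\<close>, \<open>Y\<close> is the fixed product between 0 and
    \<open>m\<close>, the other its inverse. The inverse may have negative entries, so only
    estimates with absolute values pass through it.\<close>
  obtain X Y where XY: "\<And>n. int n \<ge> m \<Longrightarrow> P n = X ** R n" "\<And>n. int n \<ge> m \<Longrightarrow> R n = Y ** P n"
  proof (cases "m \<ge> 0")
    case True
    obtain X where X: "X ** of_int_mat (mprod M 0 m) = (mat 1 :: real ^ 'd ^ 'd)" using inv by blast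
    have R: "R n = of_int_mat (mprod M 0 m) ** P n" if "int n \<ge> m" for n
      using mprod_split[OF True that, of M] by (simp add: R_def P_def of_int_mat_mult)
    then have "P n = X ** R n" if "int n \<ge> m" for n
      using that X by (simp add: matrix_mul_assoc)
    then show ?thesis using R that by blast
  next
    case False
    obtain Y where Y: "Y ** of_int_mat (mprod M m 0) = (mat 1 :: real ^ 'd ^ 'd)" using inv by blast
    have P: "P n = of_int_mat (mprod M m 0) ** R n" for n
      using mprod_split[of m 0 "int n" M] False by (simp add: R_def P_def of_int_mat_mult)
    then have "R n = Y ** P n" for n
      using Y by (simp add: matrix_mul_assoc)
    then show ?thesis using P that by blast
  qed
  obtain n1 where n1: "n1 > m" "positive_mat (mprod M m n1)"
    using prim by (auto simp: primitive_def)
  define A where "A = mprod M m n1"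
  define a where "a = entry_sum (of_int_mat A :: real ^ 'd ^ 'd)"
  have a: "1 \<le> a" unfolding a_def A_def by (rule entry_sum_of_nonneg_unimodular[OF Q])
  have Rm: "\<bar>minor (R n) i j k l\<bar> \<le> C * \<beta> ^ n * entry_sum (R n)" for n i j k l
    using minors[of n i j k l] mult_left_mono[OF entry_sum_of_nonneg_unimodular[OF M[of "int n"]],
        of "\<bar>minor (R n) i j k l\<bar>"] by (simp add: R_def)
  have R0: "1 \<le> entry_sum (R n)" for n unfolding R_def by (rule entry_sum_of_nonneg_unimodular[OF Q])
  have C0: "0 \<le> C"
    using order_trans[OF abs_ge_zero Rm[of 0]] R0[of 0] by (simp add: zero_le_mult_iff)
  define K where "K = (entry_sum X)\<^sup>2 * C * entry_sum Y"
  have Pm: "\<bar>minor (P n) i j k l\<bar> \<le> K * \<beta> ^ n * entry_sum (P n)" if n: "int n \<ge> m" for n i j k l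
  proof -
    have "\<bar>minor (P n) i j k l\<bar> \<le> (entry_sum X)\<^sup>2 * (C * \<beta> ^ n * entry_sum (R n))"
      unfolding XY(1)[OF n] by (rule minor_matrix_mult_bound[OF Rm])
    also have "\<dots> \<le> (entry_sum X)\<^sup>2 * (C * \<beta> ^ n * (entry_sum Y * entry_sum (P n)))"
      unfolding XY(2)[OF n] using C0 \<beta> by (intro mult_left_mono entry_sum_mult) auto
    finally show ?thesis by (simp add: K_def mult_ac)
  qed
  \<comment> \<open>One \<open>d\<^sup>2\<close> is the constant of
    \<open>irreducible_charpoly\<close>; \<open>d\<^sup>2 * a\<close> compares the entry sum with
    the largest diagonal entry.\<close>
  have "(\<lambda>n. (d\<^sup>2 * K * (d\<^sup>2 * a)) * \<beta> ^ n) \<longlonglongrightarrow> 0"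
    using \<beta> by (intro tendsto_mult_right_zero LIMSEQ_realpow_zero) auto
  from order_tendstoD(2)[OF this, of 1]
  obtain n2 where n2: "\<And>n. n \<ge> n2 \<Longrightarrow> (d\<^sup>2 * K * (d\<^sup>2 * a)) * \<beta> ^ n < 1"
    by (auto simp: eventually_sequentially)
  have "irreducible (charpoly (of_int_mat (mprod M m n) :: rat ^ 'd ^ 'd))"
    if n: "n \<ge> int (max n2 (nat n1))" for n
  proof -
    define k where "k = nat n"
    have k: "n = int k" "k \<ge> n2" "int k \<ge> n1" using n by (auto simp: k_def)
    define B where "B = mprod M n1 n"
    define q where "q = mprod M m n"
    have q: "q = A ** B"
      unfolding q_def A_def B_def using n1(1) k by (intro mprod_split) auto
    have Pq: "P k = of_int_mat q" by (simp add: P_def q_def k)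
    define s where "s j = (\<Sum>i\<in>UNIV. B $ i $ j)" for j
    have B0: "0 \<le> B $ i $ j" for i j using Q[of n1 n] by (simp add: B_def nonneg_unimodular_def)
    have s1: "1 \<le> s j" for j unfolding s_def B_def by (rule nonneg_unimodular_column_sum[OF Q])
    have A1: "1 \<le> A $ i $ j" for i j
      using n1(2) by (simp add: A_def positive_mat_def int_one_le_iff_zero_less)
    \<comment> \<open>The entries of \<open>A\<close> lie between 1 and \<open>a\<close>, so every
      entry of column \<open>j\<close> of \<open>q\<close> lies between \<open>s j\<close> and
      \<open>a * s j\<close>. Hence it is at most \<open>a\<close> times the diagonal entry of that
      column.\<close>
    have lower: "s j \<le> q $ i $ j" for i j
      unfolding s_def q matrix_matrix_mult_def
      using mult_right_mono[OF A1 B0] by (auto intro!: sum_mono)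
    have upper: "of_int (q $ i $ j) \<le> a * of_int (s j)" for i j
    proof -
      have "of_int (q $ i $ j) = (\<Sum>k\<in>UNIV. of_int (A $ i $ k) * of_int (B $ k $ j) :: real)"
        by (simp add: q matrix_matrix_mult_def)
      also have "\<dots> \<le> (\<Sum>k\<in>UNIV. a * of_int (B $ k $ j))"
      proof (intro sum_mono mult_right_mono)
        fix k
        show "real_of_int (A $ i $ k) \<le> a"
          using abs_le_entry_sum[of "of_int_mat A" i k] by (simp add: a_def)
      qed (simp add: B0)
      also have "\<dots> = a * of_int (s j)" by (simp add: s_def sum_distrib_left)
      finally show ?thesis .
    qed
    have "\<exists>r. \<forall>j. q $ j $ j \<le> q $ r $ r"
    proof -
      define X where "X = (\<lambda>j. q $ j $ j) ` UNIV"
      define b where "b = Max X"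
      have "b \<in> X" unfolding b_def X_def by (intro Max_in) auto
      then obtain r where r: "b = q $ r $ r" by (auto simp: X_def)
      have "q $ j $ j \<le> b" for j unfolding b_def by (intro Max_ge) (auto simp: X_def)
      then show ?thesis using r by auto
    qed
    then obtain r where r: "\<And>j. q $ j $ j \<le> q $ r $ r" by blast
    have q1: "1 \<le> q $ i $ j" for i j using lower s1 order_trans by blast
    have "entry_sum (P k) = (\<Sum>i\<in>UNIV. \<Sum>j\<in>UNIV. of_int (q $ i $ j))"
      unfolding entry_sum_def Pq using q1 by (intro sum.cong refl) (simp add: order_trans[OF zero_le_one])
    also have "\<dots> \<le> (\<Sum>i\<in>(UNIV :: 'd set). \<Sum>j\<in>(UNIV :: 'd set). a * of_int (q $ r $ r))"
    proof (intro sum_mono)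
      fix i j
      have "of_int (q $ i $ j) \<le> a * of_int (s j)" by (rule upper)
      also have "\<dots> \<le> a * of_int (q $ r $ r)"
        using a order_trans[OF lower r] by (intro mult_left_mono) auto
      finally show "real_of_int (q $ i $ j) \<le> a * of_int (q $ r $ r)" .
    qed
    also have "\<dots> = d\<^sup>2 * a * of_int (q $ r $ r)" by (simp add: d_def power2_eq_square)
    finally have E: "entry_sum (P k) \<le> d\<^sup>2 * a * of_int (q $ r $ r)" .
    have K0: "0 \<le> K" using C0 by (simp add: K_def entry_sum_nonneg)
    have "d\<^sup>2 * (K * \<beta> ^ k * entry_sum (P k)) \<le> d\<^sup>2 * (K * \<beta> ^ k * (d\<^sup>2 * a * of_int (q $ r $ r)))"
      using E K0 \<beta> by (intro mult_left_mono) auto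
    also have "\<dots> = ((d\<^sup>2 * K * (d\<^sup>2 * a)) * \<beta> ^ k) * of_int (q $ r $ r)" by (simp add: mult_ac)
    also have "\<dots> < 1 * of_int (q $ r $ r)"
      using n2[OF k(2)] q1[of r r] by (intro mult_strict_right_mono) auto
    finally have large: "(real CARD('d))\<^sup>2 * (K * \<beta> ^ k * entry_sum (P k)) < of_int (q $ r $ r)"
      by (simp add: d_def)
    have "positive_mat q" using q1 by (simp add: positive_mat_def int_one_le_iff_zero_less)
    moreover have "det q \<noteq> 0" using Q[of m n] by (auto simp: q_def nonneg_unimodular_def)
    moreover have "\<bar>minor (of_int_mat q :: real ^ 'd ^ 'd) i j l t\<bar> \<le> K * \<beta> ^ k * entry_sum (P k)" for i j l t
      using Pm[of k i j l t] k n1(1) by (simp add: Pq)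
    ultimately have "irreducible (charpoly (of_int_mat q :: rat ^ 'd ^ 'd))"
      using irreducible_charpoly large by blast
    then show ?thesis by (simp add: q_def)
  qed
  then show "\<exists>n0::nat. \<forall>n\<ge>int n0. irreducible (charpoly (of_int_mat (mprod M m n) :: rat ^ 'd ^ 'd))"
    by blast
qed

section \<open>Both time directions\<close>

lemma primitive_Pisot_sequence:
  fixes M :: "int \<Rightarrow> int ^ 'd ^ 'd"
  assumes "CARD('d) \<ge> 2" and M: "\<And>n. M n \<in> nonneg_unimodular" and "is_matrix_norm N"
    and "primitive M" "local_Pisot M" "growth_condition N M"
  shows "alg_irreducible M \<and> (\<exists>u. generalized_right_eigenvector M u \<and> rationally_independent u \<and>
                 converges_exponentially M u)"
proof (rule mprod_minors_decay[OF assms(1,2,3,5,6)])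
  fix \<beta> C
  assume *: "0 < \<beta>" "\<beta> < 1"
    "\<And>n i j k l. \<bar>minor (of_int_mat (mprod M 0 (int n))) i j k l\<bar> * entry_sum (of_int_mat (M (int n)))
        \<le> C * \<beta> ^ n * entry_sum (of_int_mat (mprod M 0 (int n)))"
  show ?thesis
    using mprod_alg_irreducible[OF M assms(4) *] exponentially_convergent_right_eigenvector[OF M *]
    by metis
qed

text \<open>Lengthening the product into the past adds a factor on the left, which transposition
  moves to the right, where \<open>mprod (past M)\<close> expects it.\<close>

lemma mprod_past: "mprod (past M) 0 (int n) = transpose (mprod M (- int n) 0)"
proof (induction n)
  case (Suc n)
  have "mprod M (- int (Suc n)) 0 = mprod M (- int (Suc n)) (- int n) ** mprod M (- int n) 0"
    by (rule mprod_split) auto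
  also have "mprod M (- int (Suc n)) (- int n) = M (- int n - 1)"
    using mprod_Suc[of "- int (Suc n)" "- int (Suc n)" M] by (simp add: minus_diff_commute[of "int n" 1])
  finally have "transpose (mprod M (- int (Suc n)) 0)
      = transpose (mprod M (- int n) 0) ** transpose (M (- int n - 1))"
    by (simp add: matrix_transpose_mul)
  moreover have "mprod (past M) 0 (int (Suc n)) = mprod (past M) 0 (int n) ** past M (int n)"
    using mprod_Suc[of 0 "int n" "past M"] by (simp add: add.commute)
  moreover have "past M (int n) = transpose (M (- int n - 1))" by (simp add: past_def)
  ultimately show ?case by (simp only: Suc.IH)
qed (simp add: transpose_mat)

lemma generalized_left_eigenvector_iff_past:
  "generalized_left_eigenvector M v \<longleftrightarrow> generalized_right_eigenvector (past M) v"
proof -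
  have *: "of_int_mat (transpose A) = (transpose (of_int_mat A) :: real ^ 'n ^ 'n)" for A :: "int ^ 'n ^ 'n"
    by (simp add: vec_eq_iff transpose_def)
  show ?thesis
    unfolding generalized_left_eigenvector_def generalized_right_eigenvector_def mprod_past * ..
qed

lemma past_nonneg_unimodular:
  assumes "\<And>n. M n \<in> nonneg_unimodular"
  shows "past M n \<in> nonneg_unimodular"
proof -
  have "det (past M n) = det (M (- n - 1))" by (simp add: past_def)
  moreover have "past M n $ i $ j = M (- n - 1) $ j $ i" for i j by (simp add: past_def transpose_def)
  ultimately show ?thesis using assms[of "- n - 1"] by (simp add: nonneg_unimodular_def)
qed

theorem theoremA:
  fixes M :: "int \<Rightarrow> int ^ 'd ^ 'd"
    and N :: "real ^ 'd ^ 'd \<Rightarrow> real"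
  assumes "CARD('d) \<ge> 2"
    and "\<And>n. M n \<in> nonneg_unimodular"
    and "is_matrix_norm N"
  shows "(primitive M \<and> local_Pisot M \<and> growth_condition N M \<longrightarrow>
            alg_irreducible M \<and>
            (\<exists>u. generalized_right_eigenvector M u \<and> rationally_independent u \<and>
                 converges_exponentially M u))
       \<and> (primitive (past M) \<and> local_Pisot (past M) \<and> growth_condition N (past M) \<longrightarrow>
            alg_irreducible (past M) \<and>
            (\<exists>u. generalized_right_eigenvector (past M) u \<and> rationally_independent u \<and>
                 converges_exponentially (past M) u) \<and>
            (\<exists>v. generalized_left_eigenvector M v \<and> rationally_independent v \<and>
                 converges_exponentially_past M v))"
  using primitive_Pisot_sequence[OF assms(1) _ assms(3), of M, OF assms(2)]
    primitive_Pisot_sequence[OF assms(1) _ assms(3), of "past M", OF past_nonneg_unimodular[of M, OF assms(2)]]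
  unfolding generalized_left_eigenvector_iff_past converges_exponentially_past_def
  by blast

end
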